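(* Let $X=\{-1,+1\}$, $T(s)=X$ for both $s\in X$, and $\psi(s,t)=t$. Fix $\beta>1$ and let $m_\beta\in(0,1)$ be the unique positive solution of $m_\beta=\tanh(\beta m_\beta)$. For $h\in\mathbb{R}$ define, for $\gamma\in\mathcal{M}(X^2)$, $$\mathcal{E}_{\beta,h}(\gamma)=\frac\beta2\Bigl(\int_{X^2}\psi\,d\gamma\Bigr)^2+h\int_{X^2}\psi\,d\gamma,\qquad\Phi_\beta(h):=\Pi_{\mathrm{top}}^{\mathcal{E}_{\beta,h}}(T).$$ Then: (i) At $h=0$ the equilibrium values are $\pm m_\beta$. For every $h\ne0$ there is a unique equilibrium value $z_{\beta,h}$, it has the sign of $h$, and $z_{\beta,h}=\tanh(\beta z_{\beta,h}+h)$. If $h>0$ then $z_{\beta,h}\in(m_\beta,1)$; if $h<0$ then $z_{\beta,h}\in(-1,-m_\beta)$. (ii) With $p_z(t)=(1+zt)/2$, the unique equilibrium pair for $h\ne0$ and its two-coordinate distribution are $$\mu_{\beta,h}(s)=p_{z_{\beta,h}}(s),\quad Q_{\beta,h}(s,t)=p_{z_{\beta,h}}(t),\quad\gamma_{\beta,h}(s,t)=p_{z_{\beta,h}}(s)p_{z_{\beta,h}}(t).$$ (iii) The function $\Phi_\beta$ is even and convex, and is real analytic on $(-\infty,0)$ and on $(0,+\infty)$. For $h\ne0$, $$\Phi_\beta(h)=\log\bigl(2\cosh(\beta z_{\beta,h}+h)\bigr)-\frac\beta2z_{\beta,h}^2.$$ Its one-sided derivatives at the origin are $\Phi_\beta'(0-)=-m_\beta$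 and $\Phi_\beta'(0+)=m_\beta$. Thus $h=0$ is a first-order transition and the equilibrium value jumps by $2m_\beta$. (iv) Set $s_\beta:=\sqrt{1-1/\beta}$ and $h_{\mathrm{sp}}(\beta):=\beta s_\beta-\operatorname{artanh}s_\beta$; then $h_{\mathrm{sp}}(\beta)>0$. For $0<|h|<h_{\mathrm{sp}}(\beta)$, the function $g_{\beta,h}(z)=\mathfrak{h}(z)+\frac\beta2z^2+hz$ on $[-1,1]$ has, in addition to its global maximum, a strict local maximum of the opposite sign and a local minimum separating the two. At $|h|=h_{\mathrm{sp}}(\beta)$ the local maximum and the local minimum coalesce. For $|h|>h_{\mathrm{sp}}(\beta)$ the global maximizer is the only critical point of $g_{\beta,h}$ in $(-1,1)$.
   Context: Finite-state conventions. Let $X$ be a finite set with the discrete metric, $T$ a map assigning to each $i\in X$ a nonempty subset $T(i)\subset X$, and $\Gamma_T=\{(i,j):j\in T(i)\}$. $\mathcal{M}(\Gamma_T)$ is the set of probability vectors on $\Gamma_T$, and $\mathcal{E}:\mathcal{M}(\Gamma_T)\to\mathbb{R}$ is continuous. A stationary transition pair $(\mu,Q)$ consists of a stochastic matrix $Q=(Q(i,j))$ with $Q(i,j)=0$ for $j\notin T(i)$ and a probability vector $\mu$ with $\sum_i\mu(i)Q(i,j)=\mu(j)$. Its two-coordinate distribution is $\gamma_{\mu,Q}(i,j)=\mu(i)Q(i,j)$, and $h_\mu(Q)$ is the entropy rate of the stationary Markov chain, $h_\mu(Q)=-\sum_{i,j}\mu(i)Q(i,j)\log Q(i,j)$ ($0\log0=0$;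 natural logarithms). A nonlinear equilibrium pair is a stationary transition pair maximizing $h_\mu(Q)+\mathcal{E}(\gamma_{\mu,Q})$ among all stationary transition pairs; equilibrium values are the numbers $\int\psi\,d\gamma_{\mu,Q}$ for nonlinear equilibrium pairs. Kernels agreeing $\mu$-a.e. are identified. Nonlinear pressure: for a path $\boldsymbol{x}=(x_0,\dots,x_n)$ with $x_{j+1}\in T(x_j)$, let $L_n(\boldsymbol{x})=\frac1n\sum_{j=0}^{n-1}\delta_{(x_j,x_{j+1})}$; then $\Pi_{\mathrm{top}}^{\mathcal{E}}(T)=\lim_{n\to\infty}\frac1n\log\sum_{\boldsymbol{x}}\exp(n\mathcal{E}(L_n(\boldsymbol{x})))$, the sum over all such paths. Localized entropy: $\mathfrak{h}(z)=\sup\{h_\mu(Q):(\mu,Q)\text{ stationary transition pair},\ \int\psi\,d\gamma_{\mu,Q}=z\}$; for the present $T,\psi$, and $z\in[-1,1]$, it is the binary entropy $\mathfrak{h}(z)=-\frac{1+z}2\log\frac{1+z}2-\frac{1-z}2\log\frac{1-z}2$. *)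

theory Defs
  imports "HOL-Analysis.Analysis"
begin

section \<open>Finite-state nonlinear thermodynamic formalism\<close>

text \<open>
  The finite state space \<open>X\<close> is a type of class \<^class>\<open>finite\<close>; a vector on \<open>X\<close> or on
  \<open>X \<times> X\<close> is a real-valued function.
\<close>

definition graph_of :: "('a \<Rightarrow> 'a set) \<Rightarrow> ('a \<times> 'a) set"
  where "graph_of T = {(i, j). j \<in> T i}"

definition prob_vector :: "('a::finite \<Rightarrow> real) \<Rightarrow> bool"
  where "prob_vector p \<longleftrightarrow> (\<forall>i. 0 \<le> p i) \<and> (\<Sum>i\<in>UNIV. p i) = 1"

definition stationary_pair ::
    "('a::finite \<Rightarrow> 'a set) \<Rightarrow> ('a \<Rightarrow> real) \<Rightarrow> ('a \<Rightarrow> 'a \<Rightarrow> real) \<Rightarrow> bool"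
  where "stationary_pair T \<mu> Q \<longleftrightarrow>
    prob_vector \<mu> \<and> (\<forall>i. prob_vector (Q i)) \<and> (\<forall>i j. j \<notin> T i \<longrightarrow> Q i j = 0) \<and>
    (\<forall>j. (\<Sum>i\<in>UNIV. \<mu> i * Q i j) = \<mu> j)"

definition two_coord :: "('a \<Rightarrow> real) \<Rightarrow> ('a \<Rightarrow> 'a \<Rightarrow> real) \<Rightarrow> 'a \<times> 'a \<Rightarrow> real"
  where "two_coord \<mu> Q = (\<lambda>(i, j). \<mu> i * Q i j)"

text \<open>The convention \<open>0 log 0 = 0\<close> holds automatically, by the factor \<open>Q i j\<close>.\<close>

definition entropy_rate :: "('a::finite \<Rightarrow> real) \<Rightarrow> ('a \<Rightarrow> 'a \<Rightarrow> real) \<Rightarrow> real"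
  where "entropy_rate \<mu> Q = - (\<Sum>i\<in>UNIV. \<Sum>j\<in>UNIV. \<mu> i * Q i j * ln (Q i j))"

definition edge_integral ::
    "('a::finite \<Rightarrow> 'a set) \<Rightarrow> ('a \<times> 'a \<Rightarrow> real) \<Rightarrow> ('a \<times> 'a \<Rightarrow> real) \<Rightarrow> real"
  where "edge_integral T \<psi> \<gamma> = (\<Sum>e\<in>graph_of T. \<psi> e * \<gamma> e)"

definition equilibrium_pair ::
    "('a::finite \<Rightarrow> 'a set) \<Rightarrow> (('a \<times> 'a \<Rightarrow> real) \<Rightarrow> real) \<Rightarrow>
     ('a \<Rightarrow> real) \<Rightarrow> ('a \<Rightarrow> 'a \<Rightarrow> real) \<Rightarrow> bool"
  where "equilibrium_pair T E \<mu> Q \<longleftrightarrow>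
    stationary_pair T \<mu> Q \<and>
    (\<forall>\<mu>' Q'. stationary_pair T \<mu>' Q' \<longrightarrow>
       entropy_rate \<mu>' Q' + E (two_coord \<mu>' Q') \<le> entropy_rate \<mu> Q + E (two_coord \<mu> Q))"

definition equilibrium_values ::
    "('a::finite \<Rightarrow> 'a set) \<Rightarrow> (('a \<times> 'a \<Rightarrow> real) \<Rightarrow> real) \<Rightarrow> ('a \<times> 'a \<Rightarrow> real) \<Rightarrow> real set"
  where "equilibrium_values T E \<psi> =
    {edge_integral T \<psi> (two_coord \<mu> Q) |\<mu> Q. equilibrium_pair T E \<mu> Q}"

text \<open>Identification of pairs: kernels need only agree \<open>\<mu>\<close>-almost everywhere.\<close>

definition same_pair ::
    "('a \<Rightarrow> real) \<Rightarrow> ('a \<Rightarrow> 'a \<Rightarrow> real) \<Rightarrow> ('a \<Rightarrow> real) \<Rightarrow> ('a \<Rightarrow> 'a \<Rightarrow> real) \<Rightarrow> bool"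
  where "same_pair \<mu> Q \<mu>' Q' \<longleftrightarrow> \<mu> = \<mu>' \<and> (\<forall>i. \<mu> i \<noteq> 0 \<longrightarrow> Q i = Q' i)"

text \<open>A path \<open>(x\<^sub>0, \<dots>, x\<^sub>n)\<close> is a list of length \<open>n + 1\<close>.\<close>

definition paths :: "('a::finite \<Rightarrow> 'a set) \<Rightarrow> nat \<Rightarrow> 'a list set"
  where "paths T n = {xs. length xs = Suc n \<and> (\<forall>j<n. xs ! Suc j \<in> T (xs ! j))}"

definition empirical :: "nat \<Rightarrow> 'a list \<Rightarrow> 'a \<times> 'a \<Rightarrow> real"
  where "empirical n xs e = real (card {j. j < n \<and> (xs ! j, xs ! Suc j) = e}) / real n"

definition finite_pressure ::
    "('a::finite \<Rightarrow> 'a set) \<Rightarrow> (('a \<times> 'a \<Rightarrow> real) \<Rightarrow> real) \<Rightarrow> nat \<Rightarrow> real"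
  where "finite_pressure T E n =
    1 / real n * ln (\<Sum>xs\<in>paths T n. exp (real n * E (empirical n xs)))"

definition nonlinear_pressure ::
    "('a::finite \<Rightarrow> 'a set) \<Rightarrow> (('a \<times> 'a \<Rightarrow> real) \<Rightarrow> real) \<Rightarrow> real"
  where "nonlinear_pressure T E = lim (finite_pressure T E)"

text \<open>
  The supremum is over the reals, so it is meaningful only when some stationary pair has
  integral \<open>z\<close>.
\<close>

definition localized_entropy ::
    "('a::finite \<Rightarrow> 'a set) \<Rightarrow> ('a \<times> 'a \<Rightarrow> real) \<Rightarrow> real \<Rightarrow> real"
  where "localized_entropy T \<psi> z =
    Sup {entropy_rate \<mu> Q |\<mu> Q.
      stationary_pair T \<mu> Q \<and> edge_integral T \<psi> (two_coord \<mu> Q) = z}"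


section \<open>The two-state mean-field model\<close>

text \<open>The state space \<open>{-1, +1}\<close> is a two-element type together with its embedding into the reals.\<close>

datatype spin = Minus | Plus

primrec spin_val :: "spin \<Rightarrow> real"
  where
    "spin_val Minus = -1"
  | "spin_val Plus = 1"

instance spin :: finite
proof
  have "(UNIV :: spin set) \<subseteq> {Minus, Plus}"
    by (auto intro: spin.exhaust)
  then show "finite (UNIV :: spin set)"
    by (rule finite_subset) simp
qed

definition full_map :: "spin \<Rightarrow> spin set"
  where "full_map s = UNIV"

definition spin_obs :: "spin \<times> spin \<Rightarrow> real"
  where "spin_obs = (\<lambda>(s, t). spin_val t)"

definition cw_energy :: "real \<Rightarrow> real \<Rightarrow> (spin \<times> spin \<Rightarrow> real) \<Rightarrow> real"
  where "cw_energy \<beta> h \<gamma> =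
    \<beta> / 2 * (edge_integral full_map spin_obs \<gamma>)\<^sup>2 + h * edge_integral full_map spin_obs \<gamma>"

definition cw_pressure :: "real \<Rightarrow> real \<Rightarrow> real"
  where "cw_pressure \<beta> h = nonlinear_pressure full_map (cw_energy \<beta> h)"

definition cw_equilibrium_values :: "real \<Rightarrow> real \<Rightarrow> real set"
  where "cw_equilibrium_values \<beta> h = equilibrium_values full_map (cw_energy \<beta> h) spin_obs"

text \<open>
  The descriptions \<open>cw_mag\<close> and \<open>cw_value\<close> denote the intended numbers only where these exist
  and are unique, namely for \<open>\<beta> > 1\<close> and, for \<open>cw_value\<close>, also \<open>h \<noteq> 0\<close>.
\<close>

definition cw_mag :: "real \<Rightarrow> real"
  where "cw_mag \<beta> = (THE m. 0 < m \<and> m = tanh (\<beta> * m))"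

definition cw_value :: "real \<Rightarrow> real \<Rightarrow> real"
  where "cw_value \<beta> h = (THE z. z \<in> cw_equilibrium_values \<beta> h)"

definition spin_prob :: "real \<Rightarrow> spin \<Rightarrow> real"
  where "spin_prob z t = (1 + z * spin_val t) / 2"

definition cw_rate :: "real \<Rightarrow> real \<Rightarrow> real \<Rightarrow> real"
  where "cw_rate \<beta> h z = localized_entropy full_map spin_obs z + \<beta> / 2 * z\<^sup>2 + h * z"

definition cw_spinodal :: "real \<Rightarrow> real"
  where "cw_spinodal \<beta> = \<beta> * sqrt (1 - 1 / \<beta>) - artanh (sqrt (1 - 1 / \<beta>))"


section \<open>Analytic notions\<close>

definition real_analytic_on :: "(real \<Rightarrow> real) \<Rightarrow> real set \<Rightarrow> bool"
  where "real_analytic_on f S \<longleftrightarrow>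
    (\<forall>x\<in>S. \<exists>r>0. \<exists>a :: nat \<Rightarrow> real. \<forall>y. \<bar>y - x\<bar> < r \<longrightarrow> (\<lambda>n. a n * (y - x) ^ n) sums f y)"

text \<open>First order in the sense of Ehrenfest: continuous, with a discontinuous first derivative.\<close>

definition first_order_transition :: "(real \<Rightarrow> real) \<Rightarrow> real \<Rightarrow> bool"
  where "first_order_transition f a \<longleftrightarrow> isCont f a \<and>
    (\<exists>l r. (f has_real_derivative l) (at_left a) \<and> (f has_real_derivative r) (at_right a) \<and> l \<noteq> r)"

definition has_jump :: "(real \<Rightarrow> real) \<Rightarrow> real \<Rightarrow> real \<Rightarrow> bool"
  where "has_jump f a d \<longleftrightarrow>
    (\<exists>l r. (f \<longlongrightarrow> l) (at_left a) \<and> (f \<longlongrightarrow> r) (at_right a) \<and> r - l = d)"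

definition unique_maximizer_on :: "real set \<Rightarrow> (real \<Rightarrow> real) \<Rightarrow> real \<Rightarrow> bool"
  where "unique_maximizer_on S f x \<longleftrightarrow> (\<forall>y. is_arg_max f (\<lambda>z. z \<in> S) y \<longleftrightarrow> y = x)"

definition strict_local_max_on :: "real set \<Rightarrow> (real \<Rightarrow> real) \<Rightarrow> real \<Rightarrow> bool"
  where "strict_local_max_on S f x \<longleftrightarrow> x \<in> S \<and> (\<forall>\<^sub>F y in at x within S. f y < f x)"

definition local_min_on :: "real set \<Rightarrow> (real \<Rightarrow> real) \<Rightarrow> real \<Rightarrow> bool"
  where "local_min_on S f x \<longleftrightarrow> x \<in> S \<and> (\<forall>\<^sub>F y in at x within S. f x \<le> f y)"

definition critical_points_in :: "real set \<Rightarrow> (real \<Rightarrow> real) \<Rightarrow> real set"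
  where "critical_points_in S f = {x \<in> S. (f has_real_derivative 0) (at x)}"

text \<open>
  \<open>cw_metastable \<beta> h zg zl zm\<close>: on \<open>[-1, 1]\<close> the rate has its global maximum at \<open>zg\<close>, a strict
  local maximum of the opposite sign at \<open>zl\<close>, and a local minimum at \<open>zm\<close> separating the two.
\<close>

definition cw_metastable :: "real \<Rightarrow> real \<Rightarrow> real \<Rightarrow> real \<Rightarrow> real \<Rightarrow> bool"
  where "cw_metastable \<beta> h zg zl zm \<longleftrightarrow>
    unique_maximizer_on {-1..1} (cw_rate \<beta> h) zg \<and>
    strict_local_max_on {-1..1} (cw_rate \<beta> h) zl \<and> zl * zg < 0 \<and>
    local_min_on {-1..1} (cw_rate \<beta> h) zm \<and> min zl zg < zm \<and> zm < max zl zg"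

text \<open>
  \<open>cw_coalescence \<beta> k zg c\<close>: as \<open>h\<close> tends to \<open>k\<close> through metastable fields, the local maximum
  and the local minimum, however selected, both tend to the point \<open>c\<close>; at the field \<open>k\<close> itself
  they have merged into \<open>c\<close>, which is the only critical point besides the global maximizer \<open>zg\<close>
  and has the opposite sign.
\<close>

definition cw_coalescence :: "real \<Rightarrow> real \<Rightarrow> real \<Rightarrow> real \<Rightarrow> bool"
  where "cw_coalescence \<beta> k zg c \<longleftrightarrow>
    unique_maximizer_on {-1..1} (cw_rate \<beta> k) zg \<and> c * zg < 0 \<and>
    critical_points_in {-1<..<1} (cw_rate \<beta> k) = {zg, c} \<and>
    (\<forall>yg yl ym :: real \<Rightarrow> real.
      (\<forall>h. 0 < \<bar>h\<bar> \<and> \<bar>h\<bar> < cw_spinodal \<beta> \<longrightarrow> cw_metastable \<beta> h (yg h) (yl h) (ym h)) \<longrightarrow>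
      (yl \<longlongrightarrow> c) (at k within {h. 0 < \<bar>h\<bar> \<and> \<bar>h\<bar> < cw_spinodal \<beta>}) \<and>
      (ym \<longlongrightarrow> c) (at k within {h. 0 < \<bar>h\<bar> \<and> \<bar>h\<bar> < cw_spinodal \<beta>}))"

end

theory Submission
  imports Defs "HOL-Complex_Analysis.Complex_Analysis"
begin

text \<open>
  The entropy rate of a stationary chain is at most the entropy of its marginal, with equality only if
  the rows of positive mass equal the marginal (\<open>entropy_rate_le_entropy\<close>). In the two-state model the
  marginal is determined by the integral \<open>z\<close> of the observable. The equilibrium problem therefore
  reduces to maximizing \<open>mean_rate \<beta> h z = binent z + \<beta> / 2 * z\<^sup>2 + h * z\<close> over \<open>[-1, 1]\<close>, and
  the equilibrium pairs are the product pairs of the maximizers (\<open>equilibrium_pairD\<close>,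
  \<open>equilibrium_pair_product\<close>).

  The Gibbs variational principle \<open>binent z + a * z \<le> ln (2 * cosh a)\<close>, with equality only at
  \<open>z = tanh a\<close>, bounds the rate by the smooth function
  \<open>mean_field \<beta> h z = ln (2 * cosh (\<beta> * z + h)) - \<beta> / 2 * z\<^sup>2\<close>, with equality exactly where
  \<open>z = tanh (\<beta> * z + h)\<close>. This equation also describes the critical points of \<open>mean_field\<close>, so the
  two functions have the same maximizers (\<open>arg_max_mean_rate\<close>). Equivalently,
  \<open>h = crit_field \<beta> z = artanh z - \<beta> * z\<close>. This odd function decreases on \<open>[-s, s]\<close> and increases
  on \<open>[s, 1)\<close>, where \<open>s\<close> is the spinodal point and \<open>crit_field \<beta> s = - cw_spinodal \<beta>\<close>. Its inverse
  \<open>upper_branch \<beta>\<close> on the increasing branch is thus defined for \<open>h > - cw_spinodal \<beta>\<close>; it gives the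
  global maximizer for \<open>h > 0\<close>, the value \<open>cw_mag \<beta>\<close> at \<open>h = 0\<close>, and, after reflection, the
  metastable maximum.

  The pressure needs no asymptotics of binomial coefficients. By convexity of the square,
  \<open>m\<^sup>2 / 2\<close> is the maximum over \<open>y\<close> of \<open>y * m - y\<^sup>2 / 2\<close>, attained at \<open>y = m\<close>. For fixed \<open>y\<close> the
  sum over paths is exactly \<open>2 * exp (n * mean_field \<beta> h y)\<close>, and the path mean takes at most \<open>n + 1\<close>
  values. Hence the partition sum agrees with \<open>exp (n * max (mean_field \<beta> h))\<close> up to a factor linear
  in \<open>n\<close> (\<open>finite_pressure_bounds\<close>), and the pressure is the maximum of \<open>mean_field \<beta> h\<close>. Convexity
  follows because this is a maximum of convex functions of \<open>h\<close>. For \<open>h \<ge> 0\<close> the pressure is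
  \<open>mean_field \<beta> h (upper_branch \<beta> h)\<close>, a formula that makes sense also for small negative \<open>h\<close> and has
  derivative \<open>upper_branch \<beta> h\<close> there; this gives the one-sided derivatives at the origin. Analyticity
  follows from the holomorphic inverse function theorem for \<open>w - \<beta> * tanh w\<close>, where
  \<open>w = \<beta> * z + h\<close>.

  The derivative of the rate at \<open>z\<close> is \<open>h - crit_field \<beta> z\<close>. The metastable maximum, the barrier
  and their coalescence at \<open>\<bar>h\<bar> = cw_spinodal \<beta>\<close> are therefore read off from the monotonicity of
  \<open>crit_field \<beta>\<close>.
\<close>

section \<open>Entropy of a stationary pair\<close>

lemma gibbs_pointwise:
  fixes p q :: real
  assumes "0 \<le> q" "0 < p"
  shows "q * ln p - q * ln q \<le> p - q"
    and "q * ln p - q * ln q = p - q \<longleftrightarrow> q = p"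
proof -
  have *: "q * ln p - q * ln q = q * ln (p / q)" "q * (p / q - 1) = p - q" if "0 < q"
    using that assms by (auto simp: ln_div field_simps)
  have "ln (p / q) \<le> p / q - 1" if "0 < q"
    using that assms by (intro ln_le_minus_one) auto
  then have "q * ln (p / q) \<le> q * (p / q - 1)" if "0 < q"
    using that by (intro mult_left_mono) auto
  then show "q * ln p - q * ln q \<le> p - q"
    using assms * by (cases "q = 0") auto
  show "q * ln p - q * ln q = p - q \<longleftrightarrow> q = p"
  proof (cases "q = 0")
    case False
    then have q: "0 < q" using assms by auto
    have "p / q = 1" if "q * ln (p / q) = q * (p / q - 1)"
      using that q assms ln_eq_minus_one[of "p / q"] by (simp add: divide_pos_pos)
    then show ?thesis
      using * q by auto
  qed (use assms in auto)
qed

text \<open>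
  The entropy rate of a chain is at most the entropy of its marginal, because the average relative
  entropy of the rows with respect to the marginal is nonnegative; it vanishes only if every row of
  positive mass is the marginal.
\<close>

lemma entropy_rate_le_entropy:
  assumes st: "stationary_pair T \<mu> Q"
  shows "entropy_rate \<mu> Q \<le> - (\<Sum>j\<in>UNIV. \<mu> j * ln (\<mu> j))"
    and "entropy_rate \<mu> Q = - (\<Sum>j\<in>UNIV. \<mu> j * ln (\<mu> j)) \<Longrightarrow> same_pair \<mu> Q \<mu> (\<lambda>_. \<mu>)"
proof -
  have mu: "0 \<le> \<mu> i" "(\<Sum>i\<in>UNIV. \<mu> i) = 1" and Q: "0 \<le> Q i j" "(\<Sum>j\<in>UNIV. Q i j) = 1"
    and inv: "(\<Sum>i\<in>UNIV. \<mu> i * Q i j) = \<mu> j" for i j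
    using st by (auto simp: stationary_pair_def prob_vector_def)
  \<comment> \<open>The deficit in the pointwise Gibbs inequality, whose sum is the entropy difference.\<close>
  define d where "d i j = \<mu> i * (\<mu> j - Q i j) - (\<mu> i * Q i j * ln (\<mu> j) - \<mu> i * Q i j * ln (Q i j))"
    for i j
  have null: "\<mu> i * Q i j = 0" if "\<mu> j = 0" for i j
    using inv[of j] that mu Q by (simp add: sum_nonneg_eq_0_iff)
  have d_eq: "d i j = \<mu> i * ((\<mu> j - Q i j) - (Q i j * ln (\<mu> j) - Q i j * ln (Q i j)))" for i j
    by (simp add: d_def algebra_simps)
  have d_nonneg: "0 \<le> d i j" for i j
  proof (cases "\<mu> j = 0")
    case True
    then show ?thesis using null[of j i] by (auto simp: d_def algebra_simps)
  next
    case False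
    then show ?thesis
      unfolding d_eq using mu Q gibbs_pointwise(1)[of "Q i j" "\<mu> j"]
      by (intro mult_nonneg_nonneg) (auto simp: less_le)
  qed
  have d_zero: "Q i j = \<mu> j" if "d i j = 0" "\<mu> i \<noteq> 0" for i j
  proof (cases "\<mu> j = 0")
    case True
    then show ?thesis using null[of j i] that by auto
  next
    case False
    have "0 < \<mu> j" using mu(1)[of j] False by linarith
    then show ?thesis
      using that gibbs_pointwise(2)[of "Q i j" "\<mu> j"] Q by (auto simp: d_eq)
  qed
  have "(\<Sum>i\<in>UNIV. \<Sum>j\<in>UNIV. \<mu> i * (\<mu> j - Q i j)) = 0"
    using mu Q by (simp add: sum_distrib_left[symmetric] sum_subtractf)
  moreover have "(\<Sum>i\<in>UNIV. \<Sum>j\<in>UNIV. \<mu> i * Q i j * ln (\<mu> j)) = (\<Sum>j\<in>UNIV. \<mu> j * ln (\<mu> j))"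
    by (subst sum.swap) (simp add: sum_distrib_right[symmetric] inv)
  ultimately have sum_d: "(\<Sum>i\<in>UNIV. \<Sum>j\<in>UNIV. d i j)
      = - (\<Sum>j\<in>UNIV. \<mu> j * ln (\<mu> j)) - entropy_rate \<mu> Q"
    by (simp add: d_def sum_subtractf entropy_rate_def)
  show "entropy_rate \<mu> Q \<le> - (\<Sum>j\<in>UNIV. \<mu> j * ln (\<mu> j))"
    using sum_d sum_nonneg[of UNIV "\<lambda>i. \<Sum>j\<in>UNIV. d i j"] d_nonneg by (simp add: sum_nonneg)
  assume "entropy_rate \<mu> Q = - (\<Sum>j\<in>UNIV. \<mu> j * ln (\<mu> j))"
  then have "(\<Sum>i\<in>UNIV. \<Sum>j\<in>UNIV. d i j) = 0"
    using sum_d by simp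
  then have "d i j = 0" for i j
    using d_nonneg by (simp add: sum_nonneg_eq_0_iff sum_nonneg)
  then show "same_pair \<mu> Q \<mu> (\<lambda>_. \<mu>)"
    using d_zero by (auto simp: same_pair_def)
qed

text \<open>The entropy of the law on \<open>{-1, +1}\<close> with mean \<open>z \<in> [-1, 1]\<close>; by the factors in front of the
  logarithms, it is \<open>0\<close> at the endpoints.\<close>

definition binent :: "real \<Rightarrow> real"
  where "binent z = - ((1 + z) / 2 * ln ((1 + z) / 2)) - (1 - z) / 2 * ln ((1 - z) / 2)"

lemma binent_minus: "binent (- z) = binent z"
  by (simp add: binent_def)

lemma UNIV_spin: "(UNIV :: spin set) = {Minus, Plus}"
  by (auto intro: spin.exhaust)

lemma sum_spin: "(\<Sum>s\<in>UNIV. f s) = f Minus + f Plus"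
  by (simp add: UNIV_spin)

lemma all_spin: "(\<forall>s. P s) \<longleftrightarrow> P Minus \<and> P Plus"
  by (metis spin.exhaust)

lemma edge_integral_full_map: "edge_integral full_map \<psi> \<gamma> = (\<Sum>s\<in>UNIV. \<Sum>t\<in>UNIV. \<psi> (s, t) * \<gamma> (s, t))"
  by (simp add: edge_integral_def graph_of_def full_map_def sum.cartesian_product
      flip: UNIV_Times_UNIV)

text \<open>A stationary pair for the two-state model has only one law as marginal: the one with mean the
  integral of the observable.\<close>

lemma stationary_pair_marginal:
  assumes "stationary_pair full_map \<mu> Q"
  defines "z \<equiv> edge_integral full_map spin_obs (two_coord \<mu> Q)"
  shows "\<mu> = spin_prob z" and "z \<in> {-1..1}"
proof -
  have mu: "0 \<le> \<mu> Minus" "0 \<le> \<mu> Plus" "\<mu> Minus + \<mu> Plus = 1"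
    and inv: "\<mu> Minus * Q Minus j + \<mu> Plus * Q Plus j = \<mu> j" for j
    using assms(1) by (simp_all add: stationary_pair_def prob_vector_def sum_spin)
  have z: "z = \<mu> Plus - \<mu> Minus"
    using inv[of Minus] inv[of Plus]
    by (simp add: z_def edge_integral_full_map sum_spin spin_obs_def two_coord_def)
  show "z \<in> {-1..1}" using z mu by auto
  show "\<mu> = spin_prob z"
  proof
    fix s show "\<mu> s = spin_prob z s"
      using mu by (cases s) (auto simp: spin_prob_def z field_simps)
  qed
qed

lemma entropy_spin_prob: "- (\<Sum>j\<in>UNIV. spin_prob z j * ln (spin_prob z j)) = binent z"
  by (simp add: sum_spin spin_prob_def binent_def)

lemma product_pair:
  assumes "z \<in> {-1..1}"
  shows "stationary_pair full_map (spin_prob z) (\<lambda>s. spin_prob z)"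
    and "edge_integral full_map spin_obs (two_coord (spin_prob z) (\<lambda>s. spin_prob z)) = z"
    and "entropy_rate (spin_prob z) (\<lambda>s. spin_prob z) = binent z"
proof -
  have pr: "prob_vector (spin_prob z)"
    using assms by (auto simp: prob_vector_def all_spin sum_spin spin_prob_def field_simps)
  then show "stationary_pair full_map (spin_prob z) (\<lambda>s. spin_prob z)"
    by (auto simp: stationary_pair_def full_map_def prob_vector_def simp flip: sum_distrib_right)
  show "edge_integral full_map spin_obs (two_coord (spin_prob z) (\<lambda>s. spin_prob z)) = z"
    by (simp add: edge_integral_full_map sum_spin two_coord_def spin_obs_def spin_prob_def field_simps)
  show "entropy_rate (spin_prob z) (\<lambda>s. spin_prob z) = binent z"
    using pr unfolding entropy_spin_prob[symmetric] entropy_rate_def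
    by (subst sum.swap) (simp add: mult.assoc prob_vector_def flip: sum_distrib_right)
qed

lemma entropy_rate_le_binent:
  assumes "stationary_pair full_map \<mu> Q"
  defines "z \<equiv> edge_integral full_map spin_obs (two_coord \<mu> Q)"
  shows "entropy_rate \<mu> Q \<le> binent z"
    and "entropy_rate \<mu> Q = binent z \<Longrightarrow> same_pair \<mu> Q (spin_prob z) (\<lambda>s. spin_prob z)"
  using entropy_rate_le_entropy[OF assms(1)] entropy_spin_prob[of z]
    stationary_pair_marginal(1)[OF assms(1), folded z_def]
  by metis+

lemma localized_entropy_eq:
  assumes "z \<in> {-1..1}"
  shows "localized_entropy full_map spin_obs z = binent z"
  unfolding localized_entropy_def
proof (rule cSup_eq_maximum)
  show "binent z \<in> {entropy_rate \<mu> Q |\<mu> Q.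
      stationary_pair full_map \<mu> Q \<and> edge_integral full_map spin_obs (two_coord \<mu> Q) = z}"
    using product_pair[OF assms] by (metis (mono_tags, lifting) mem_Collect_eq)
qed (use entropy_rate_le_binent(1) in blast)

text \<open>The function of the mean to which both variational problems reduce.\<close>

definition mean_rate :: "real \<Rightarrow> real \<Rightarrow> real \<Rightarrow> real"
  where "mean_rate \<beta> h z = binent z + \<beta> / 2 * z\<^sup>2 + h * z"

lemma cw_rate_eq: "z \<in> {-1..1} \<Longrightarrow> cw_rate \<beta> h z = mean_rate \<beta> h z"
  by (simp add: cw_rate_def mean_rate_def localized_entropy_eq)

lemma mean_rate_minus: "mean_rate \<beta> (- h) (- z) = mean_rate \<beta> h z"
  by (simp add: mean_rate_def binent_minus)

text \<open>The objective of a stationary pair is bounded by the rate at its mean, with equality only for the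
  product pair of that mean.\<close>

lemma objective_le_mean_rate:
  assumes "stationary_pair full_map \<mu> Q"
  defines "z \<equiv> edge_integral full_map spin_obs (two_coord \<mu> Q)"
  shows "entropy_rate \<mu> Q + cw_energy \<beta> h (two_coord \<mu> Q) \<le> mean_rate \<beta> h z"
    and "mean_rate \<beta> h z \<le> entropy_rate \<mu> Q + cw_energy \<beta> h (two_coord \<mu> Q) \<Longrightarrow>
      same_pair \<mu> Q (spin_prob z) (\<lambda>s. spin_prob z)"
proof -
  have *: "entropy_rate \<mu> Q \<le> binent z"
    "entropy_rate \<mu> Q = binent z \<Longrightarrow> same_pair \<mu> Q (spin_prob z) (\<lambda>s. spin_prob z)"
    using entropy_rate_le_binent[OF assms(1)] by (auto simp: z_def)
  then show "entropy_rate \<mu> Q + cw_energy \<beta> h (two_coord \<mu> Q) \<le> mean_rate \<beta> h z"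
    by (simp add: mean_rate_def cw_energy_def z_def)
  assume "mean_rate \<beta> h z \<le> entropy_rate \<mu> Q + cw_energy \<beta> h (two_coord \<mu> Q)"
  then have "binent z \<le> entropy_rate \<mu> Q"
    by (simp add: mean_rate_def cw_energy_def z_def)
  with * show "same_pair \<mu> Q (spin_prob z) (\<lambda>s. spin_prob z)"
    by simp
qed

lemma objective_product_pair:
  assumes "z \<in> {-1..1}"
  shows "entropy_rate (spin_prob z) (\<lambda>s. spin_prob z)
    + cw_energy \<beta> h (two_coord (spin_prob z) (\<lambda>s. spin_prob z)) = mean_rate \<beta> h z"
  using product_pair[OF assms] by (simp add: mean_rate_def cw_energy_def)

text \<open>The product pair of a maximizer of the rate is a nonlinear equilibrium pair, and every
  nonlinear equilibrium pair is of this form, up to rows of mass zero.\<close>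

lemma equilibrium_pair_product:
  assumes "is_arg_max (mean_rate \<beta> h) (\<lambda>z. z \<in> {-1..1}) z"
  shows "equilibrium_pair full_map (cw_energy \<beta> h) (spin_prob z) (\<lambda>s. spin_prob z)"
proof -
  have z: "z \<in> {-1..1}" and max: "y \<in> {-1..1} \<Longrightarrow> mean_rate \<beta> h y \<le> mean_rate \<beta> h z" for y
    using assms by (auto simp: is_arg_max_linorder)
  show ?thesis
    unfolding equilibrium_pair_def objective_product_pair[OF z]
    using product_pair(1)[OF z] objective_le_mean_rate(1) max stationary_pair_marginal(2)
    by (meson order_trans)
qed

lemma equilibrium_pairD:
  assumes "equilibrium_pair full_map (cw_energy \<beta> h) \<mu> Q"
  defines "z \<equiv> edge_integral full_map spin_obs (two_coord \<mu> Q)"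
  shows "is_arg_max (mean_rate \<beta> h) (\<lambda>z. z \<in> {-1..1}) z"
    and "same_pair \<mu> Q (spin_prob z) (\<lambda>s. spin_prob z)"
proof -
  have st: "stationary_pair full_map \<mu> Q"
    using assms(1) by (simp add: equilibrium_pair_def)
  have z: "z \<in> {-1..1}"
    using stationary_pair_marginal(2)[OF st] by (simp add: z_def)
  have ge: "mean_rate \<beta> h y \<le> entropy_rate \<mu> Q + cw_energy \<beta> h (two_coord \<mu> Q)"
    if "y \<in> {-1..1}" for y
    using assms(1) product_pair(1)[OF that]
    unfolding equilibrium_pair_def objective_product_pair[OF that, symmetric] by blast
  show "same_pair \<mu> Q (spin_prob z) (\<lambda>s. spin_prob z)"
    using objective_le_mean_rate(2)[OF st] ge[OF z] by (simp add: z_def)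
  show "is_arg_max (mean_rate \<beta> h) (\<lambda>z. z \<in> {-1..1}) z"
    using ge z objective_le_mean_rate(1)[OF st, of \<beta> h]
    by (fastforce simp: is_arg_max_linorder z_def)
qed

lemma cw_equilibrium_values_eq:
  "cw_equilibrium_values \<beta> h = {z. is_arg_max (mean_rate \<beta> h) (\<lambda>z. z \<in> {-1..1}) z}"
proof (intro equalityI subsetI)
  fix z assume "z \<in> cw_equilibrium_values \<beta> h"
  then show "z \<in> {z. is_arg_max (mean_rate \<beta> h) (\<lambda>z. z \<in> {-1..1}) z}"
    using equilibrium_pairD(1) by (auto simp: cw_equilibrium_values_def equilibrium_values_def)
next
  fix z assume "z \<in> {z. is_arg_max (mean_rate \<beta> h) (\<lambda>z. z \<in> {-1..1}) z}"
  then have max: "is_arg_max (mean_rate \<beta> h) (\<lambda>z. z \<in> {-1..1}) z" and z: "z \<in> {-1..1}"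
    by (auto simp: is_arg_max_linorder)
  have "edge_integral full_map spin_obs (two_coord (spin_prob z) (\<lambda>s. spin_prob z))
      \<in> cw_equilibrium_values \<beta> h"
    using equilibrium_pair_product[OF max]
    unfolding cw_equilibrium_values_def equilibrium_values_def by blast
  then show "z \<in> cw_equilibrium_values \<beta> h"
    using product_pair(2)[OF z] by simp
qed

section \<open>The mean-field functional\<close>

text \<open>
  Replacing the entropy in the rate by its Legendre bound at slope \<open>\<beta> * y + h\<close> gives a function
  that dominates the rate on \<open>[-1, 1]\<close> and is smooth on the whole line.
\<close>

definition mean_field :: "real \<Rightarrow> real \<Rightarrow> real \<Rightarrow> real"
  where "mean_field \<beta> h y = ln (2 * cosh (\<beta> * y + h)) - \<beta> / 2 * y\<^sup>2"

lemma mean_field_has_derivative: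
  "(mean_field \<beta> h has_real_derivative \<beta> * (tanh (\<beta> * y + h) - y)) (at y)"
  unfolding mean_field_def[abs_def]
  by (auto intro!: derivative_eq_intros simp: tanh_def field_simps)

lemma mean_field_minus: "mean_field \<beta> (- h) (- y) = mean_field \<beta> h y"
proof -
  have "cosh (- (\<beta> * y) - h) = cosh (\<beta> * y + h)"
    using cosh_minus[of "\<beta> * y + h"] by (simp del: cosh_minus)
  then show ?thesis
    by (simp add: mean_field_def)
qed

text \<open>The Gibbs variational principle on two points.\<close>

lemma binent_le_ln_cosh:
  assumes "z \<in> {-1..1}"
  shows "binent z + a * z \<le> ln (2 * cosh a)"
    and "binent z + a * z = ln (2 * cosh a) \<longleftrightarrow> z = tanh a"
proof -
  \<comment> \<open>The Gibbs weights of the two points at slope \<open>a\<close>.\<close>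
  define p m where "p = exp a / (2 * cosh a)" and "m = exp (- a) / (2 * cosh a)"
  have c: "2 * cosh a = exp a + exp (- a)"
    by (simp add: cosh_def)
  have pm: "0 < p" "0 < m" "p + m = 1" "p - m = tanh a"
    by (auto simp: p_def m_def tanh_def sinh_def c add_pos_pos less_imp_neq[OF add_pos_pos, symmetric]
        simp flip: add_divide_distrib diff_divide_distrib)
  have ln: "ln p = a - ln (2 * cosh a)" "ln m = - a - ln (2 * cosh a)"
    by (simp_all add: p_def m_def ln_div)
  define q r where "q = (1 + z) / 2" and "r = (1 - z) / 2"
  have qr: "0 \<le> q" "0 \<le> r" "q + r = 1" "q - r = z"
    using assms by (auto simp: q_def r_def field_simps)
  have binent: "binent z = - (q * ln q) - r * ln r"
    by (simp only: binent_def q_def r_def)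
  define u v where "u = q * ln p - q * ln q" and "v = r * ln m - r * ln r"
  have "u + v = binent z + a * (q - r) - (q + r) * ln (2 * cosh a)"
    by (simp add: u_def v_def ln binent algebra_simps)
  then have sum: "u + v = binent z + a * z - ln (2 * cosh a)"
    using qr by simp
  have le: "u \<le> p - q" "v \<le> m - r"
    using gibbs_pointwise(1)[OF qr(1) pm(1)] gibbs_pointwise(1)[OF qr(2) pm(2)]
    by (auto simp: u_def v_def)
  have eq: "u = p - q \<longleftrightarrow> q = p" "v = m - r \<longleftrightarrow> r = m"
    using gibbs_pointwise(2)[OF qr(1) pm(1)] gibbs_pointwise(2)[OF qr(2) pm(2)]
    by (auto simp: u_def v_def)
  show "binent z + a * z \<le> ln (2 * cosh a)"
    using sum le pm qr by linarith
  have "binent z + a * z = ln (2 * cosh a) \<longleftrightarrow> u = p - q \<and> v = m - r"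
    using sum le pm qr by linarith
  also have "\<dots> \<longleftrightarrow> z = tanh a"
    using eq pm qr by auto
  finally show "binent z + a * z = ln (2 * cosh a) \<longleftrightarrow> z = tanh a" .
qed

lemma mean_rate_le_mean_field:
  assumes "z \<in> {-1..1}"
  shows "mean_rate \<beta> h z \<le> mean_field \<beta> h z"
    and "mean_rate \<beta> h z = mean_field \<beta> h z \<longleftrightarrow> z = tanh (\<beta> * z + h)"
proof -
  have "mean_rate \<beta> h z = binent z + (\<beta> * z + h) * z - \<beta> / 2 * z\<^sup>2"
    by (simp add: mean_rate_def power2_eq_square algebra_simps)
  then show "mean_rate \<beta> h z \<le> mean_field \<beta> h z"
    and "mean_rate \<beta> h z = mean_field \<beta> h z \<longleftrightarrow> z = tanh (\<beta> * z + h)"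
    using binent_le_ln_cosh[OF assms, of "\<beta> * z + h"] by (auto simp: mean_field_def)
qed

lemma arg_max_mean_rate_minus:
  "is_arg_max (mean_rate \<beta> (- h)) (\<lambda>z. z \<in> {-1..1}) (- z) \<longleftrightarrow>
    is_arg_max (mean_rate \<beta> h) (\<lambda>z. z \<in> {-1..1}) z"
proof -
  have "is_arg_max (mean_rate \<beta> (- h)) (\<lambda>z. z \<in> {-1..1}) (- z)"
    if "is_arg_max (mean_rate \<beta> h) (\<lambda>z. z \<in> {-1..1}) z" for h z
  proof -
    have "mean_rate \<beta> (- h) y \<le> mean_rate \<beta> (- h) (- z)" if "y \<in> {-1..1}" for y
      using \<open>is_arg_max _ _ _\<close> that mean_rate_minus[of \<beta> h z] mean_rate_minus[of \<beta> h "- y"]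
      by (auto simp: is_arg_max_linorder)
    then show ?thesis
      using that by (auto simp: is_arg_max_linorder)
  qed
  from this[of h z] this[of "- h" "- z"] show ?thesis by auto
qed

section \<open>The critical-point equation\<close>

text \<open>The field for which \<open>z \<in> (-1, 1)\<close> is a critical point of the rate.\<close>

definition crit_field :: "real \<Rightarrow> real \<Rightarrow> real"
  where "crit_field \<beta> z = artanh z - \<beta> * z"

text \<open>The point at which \<open>crit_field \<beta>\<close> attains its minimum over \<open>[0, 1)\<close>, for \<open>\<beta> > 1\<close>.\<close>

definition spinodal_point :: "real \<Rightarrow> real"
  where "spinodal_point \<beta> = sqrt (1 - 1 / \<beta>)"

text \<open>The inverse of \<open>crit_field \<beta>\<close> on its upper increasing branch, meaningful for
  \<open>h > - cw_spinodal \<beta>\<close>.\<close>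

definition upper_branch :: "real \<Rightarrow> real \<Rightarrow> real"
  where "upper_branch \<beta> h = (THE z. spinodal_point \<beta> < z \<and> z < 1 \<and> crit_field \<beta> z = h)"

lemma tanh_artanh_real:
  fixes z :: real
  assumes "\<bar>z\<bar> < 1"
  shows "tanh (artanh z) = z"
proof -
  have "exp (- 2 * artanh z) = (1 - z) / (1 + z)"
    using assms by (simp add: artanh_def exp_minus abs_less_iff)
  then show ?thesis
    using assms by (simp add: tanh_real_altdef del: mult_minus_left) (simp add: divide_simps)
qed

lemma crit_field_iff:
  assumes "\<bar>z\<bar> < 1"
  shows crit_field_eq_iff: "crit_field \<beta> z = h \<longleftrightarrow> z = tanh (\<beta> * z + h)"
    and crit_field_less_iff: "crit_field \<beta> z < h \<longleftrightarrow> z < tanh (\<beta> * z + h)"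
proof -
  have "crit_field \<beta> z = h \<longleftrightarrow> artanh z = \<beta> * z + h" "crit_field \<beta> z < h \<longleftrightarrow> artanh z < \<beta> * z + h"
    by (auto simp: crit_field_def)
  then show "crit_field \<beta> z = h \<longleftrightarrow> z = tanh (\<beta> * z + h)" "crit_field \<beta> z < h \<longleftrightarrow> z < tanh (\<beta> * z + h)"
    using tanh_real_eq_iff[of "artanh z"] tanh_real_less_iff[of "artanh z"] tanh_artanh_real[OF assms]
    by metis+
qed

lemma crit_field_0 [simp]: "crit_field \<beta> 0 = 0"
  by (simp add: crit_field_def)

lemma crit_field_minus: "\<bar>z\<bar> < 1 \<Longrightarrow> crit_field \<beta> (- z) = - crit_field \<beta> z"
  by (simp add: crit_field_def)

lemma crit_field_has_derivative:
  assumes "\<bar>z\<bar> < 1"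
  shows "(crit_field \<beta> has_real_derivative 1 / (1 - z\<^sup>2) - \<beta>) (at z)"
  unfolding crit_field_def using assms by (auto intro!: derivative_eq_intros)

lemma continuous_crit_field: "S \<subseteq> {-1<..<1} \<Longrightarrow> continuous_on S (crit_field \<beta>)"
  unfolding crit_field_def by (intro continuous_intros) auto

text \<open>The maximizer of the rate at a nonzero field, for \<open>\<beta> > 1\<close>.\<close>

definition field_value :: "real \<Rightarrow> real \<Rightarrow> real"
  where "field_value \<beta> h = (if 0 < h then upper_branch \<beta> h else - upper_branch \<beta> (- h))"

lemma field_value_minus: "h \<noteq> 0 \<Longrightarrow> field_value \<beta> (- h) = - field_value \<beta> h"
  by (auto simp: field_value_def)

context
  fixes \<beta> :: real
  assumes beta: "1 < \<beta>"
begin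

lemma spinodal_point_bounds: "0 < spinodal_point \<beta>" "spinodal_point \<beta> < 1"
  and spinodal_point_sq: "(spinodal_point \<beta>)\<^sup>2 = 1 - 1 / \<beta>"
  using beta by (auto simp: spinodal_point_def)

lemma cw_spinodal_eq: "cw_spinodal \<beta> = - crit_field \<beta> (spinodal_point \<beta>)"
  by (simp add: cw_spinodal_def crit_field_def spinodal_point_def)

lemma crit_field_decreasing:
  assumes "- spinodal_point \<beta> \<le> x" "x < y" "y \<le> spinodal_point \<beta>"
  shows "crit_field \<beta> y < crit_field \<beta> x"
proof (rule DERIV_neg_imp_decreasing_open[OF assms(2)])
  fix z assume z: "x < z" "z < y"
  then have z1: "\<bar>z\<bar> < spinodal_point \<beta>" "\<bar>z\<bar> < 1"
    using assms spinodal_point_bounds by auto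
  then have "z\<^sup>2 < 1 - 1 / \<beta>"
    using power_strict_mono[of "\<bar>z\<bar>" "spinodal_point \<beta>" 2] by (simp add: spinodal_point_sq)
  moreover from this have "z\<^sup>2 < 1"
    using beta by (simp add: less_diff_eq) (smt (verit) divide_pos_pos)
  ultimately have "1 / (1 - z\<^sup>2) < \<beta>"
    using beta by (simp add: field_simps)
  then show "\<exists>D. (crit_field \<beta> has_real_derivative D) (at z) \<and> D < 0"
    using crit_field_has_derivative[OF z1(2)] by force
qed (use assms spinodal_point_bounds in \<open>auto intro!: continuous_crit_field\<close>)

lemma crit_field_deriv_pos:
  assumes "spinodal_point \<beta> < z" "z < 1"
  shows "0 < 1 / (1 - z\<^sup>2) - \<beta>"
proof -
  have "z\<^sup>2 < 1"
    using assms spinodal_point_bounds power_strict_mono[of z 1 2] by simp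
  moreover have "1 - 1 / \<beta> < z\<^sup>2"
    using assms spinodal_point_bounds power_strict_mono[of "spinodal_point \<beta>" z 2]
    by (simp add: spinodal_point_sq)
  ultimately show ?thesis
    using beta by (simp add: field_simps)
qed

lemma crit_field_increasing:
  assumes "spinodal_point \<beta> \<le> x" "x < y" "y < 1"
  shows "crit_field \<beta> x < crit_field \<beta> y"
proof (rule DERIV_pos_imp_increasing_open[OF assms(2)])
  fix z assume z: "x < z" "z < y"
  then show "\<exists>D. (crit_field \<beta> has_real_derivative D) (at z) \<and> 0 < D"
    using crit_field_has_derivative[of z \<beta>] crit_field_deriv_pos[of z] assms spinodal_point_bounds
    by force
qed (use assms spinodal_point_bounds in \<open>auto intro!: continuous_crit_field\<close>)

lemma cw_spinodal_pos: "0 < cw_spinodal \<beta>"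
  using crit_field_decreasing[of 0 "spinodal_point \<beta>"] spinodal_point_bounds
  by (simp add: cw_spinodal_eq)

lemma ex1_upper_branch:
  assumes "- cw_spinodal \<beta> < h"
  shows "\<exists>!z. spinodal_point \<beta> < z \<and> z < 1 \<and> crit_field \<beta> z = h"
proof -
  let ?s = "spinodal_point \<beta>"
  \<comment> \<open>At \<open>tanh w\<close> the field exceeds \<open>w - \<beta>\<close>, so this \<open>w\<close> brings it above \<open>h\<close>.\<close>
  define w where "w = \<bar>h\<bar> + \<beta> + \<bar>artanh ?s\<bar>"
  have "tanh (artanh ?s) < tanh w"
    using beta by (auto simp: w_def)
  then have s: "?s < tanh w"
    using spinodal_point_bounds by (simp add: tanh_artanh_real)
  have "\<beta> * tanh w \<le> \<beta> * 1"
    using beta tanh_real_lt_1[of w] by (intro mult_left_mono) auto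
  then have "h \<le> crit_field \<beta> (tanh w)"
    by (simp add: crit_field_def artanh_tanh_real w_def)
  then obtain z where z: "?s \<le> z" "z \<le> tanh w" "crit_field \<beta> z = h"
    using IVT'[of "crit_field \<beta>" ?s h "tanh w"] assms s spinodal_point_bounds tanh_real_lt_1[of w]
      continuous_crit_field[of "{?s..tanh w}" \<beta>]
    by (auto simp: cw_spinodal_eq subset_iff)
  moreover have "z \<noteq> ?s"
    using z assms by (auto simp: cw_spinodal_eq)
  ultimately have ex: "?s < z \<and> z < 1 \<and> crit_field \<beta> z = h"
    using tanh_real_lt_1[of w] by simp
  show ?thesis
  proof (rule ex1I[of _ z])
    fix y assume "?s < y \<and> y < 1 \<and> crit_field \<beta> y = h"
    with ex show "y = z"
      using crit_field_increasing[of y z] crit_field_increasing[of z y]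
      by (cases y z rule: linorder_cases) auto
  qed (rule ex)
qed

lemma upper_branch:
  assumes "- cw_spinodal \<beta> < h"
  shows "spinodal_point \<beta> < upper_branch \<beta> h" "upper_branch \<beta> h < 1"
    "0 < upper_branch \<beta> h" "crit_field \<beta> (upper_branch \<beta> h) = h"
  using theI'[OF ex1_upper_branch[OF assms], folded upper_branch_def] spinodal_point_bounds by auto

lemma upper_branch_crit_field:
  assumes "spinodal_point \<beta> < z" "z < 1"
  shows "upper_branch \<beta> (crit_field \<beta> z) = z"
proof -
  have "- cw_spinodal \<beta> < crit_field \<beta> z"
    using crit_field_increasing[OF order_refl assms] by (simp add: cw_spinodal_eq)
  from the1_equality[OF ex1_upper_branch[OF this]] show ?thesis
    using assms by (simp add: upper_branch_def)
qed

lemma upper_branch_strict_mono: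
  assumes "- cw_spinodal \<beta> < h" "h < k"
  shows "upper_branch \<beta> h < upper_branch \<beta> k"
proof (rule ccontr)
  assume "\<not> ?thesis"
  moreover have "upper_branch \<beta> h \<noteq> upper_branch \<beta> k"
    using upper_branch(4)[of h] upper_branch(4)[of k] assms by auto
  ultimately show False
    using crit_field_increasing[of "upper_branch \<beta> k" "upper_branch \<beta> h"]
      upper_branch[of h] upper_branch[of k] assms by auto
qed

lemma isCont_upper_branch:
  assumes "- cw_spinodal \<beta> < h"
  shows "isCont (upper_branch \<beta>) h"
proof -
  let ?z = "upper_branch \<beta> h"
  obtain a b where ab: "spinodal_point \<beta> < a" "a < ?z" "?z < b" "b < 1"
    using upper_branch(1,2)[OF assms] by (meson dense)
  have "isCont (upper_branch \<beta>) (crit_field \<beta> ?z)"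
  proof (rule isCont_inverse_function2[OF ab(2,3)])
    fix z assume z: "a \<le> z" "z \<le> b"
    then show "upper_branch \<beta> (crit_field \<beta> z) = z"
      using ab by (intro upper_branch_crit_field) auto
    show "isCont (crit_field \<beta>) z"
      using z ab spinodal_point_bounds by (intro DERIV_isCont[OF crit_field_has_derivative]) auto
  qed
  then show ?thesis
    by (simp add: upper_branch(4)[OF assms])
qed

lemma upper_branch_has_derivative:
  assumes "- cw_spinodal \<beta> < h"
  shows "\<exists>D. (upper_branch \<beta> has_real_derivative D) (at h)"
proof (rule exI)
  show "(upper_branch \<beta> has_real_derivative inverse (1 / (1 - (upper_branch \<beta> h)\<^sup>2) - \<beta>)) (at h)"
  proof (rule DERIV_inverse_function[where a = "- cw_spinodal \<beta>" and b = "h + 1"])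
    show "(crit_field \<beta> has_real_derivative 1 / (1 - (upper_branch \<beta> h)\<^sup>2) - \<beta>)
        (at (upper_branch \<beta> h))"
      using upper_branch[OF assms] by (intro crit_field_has_derivative) auto
    show "1 / (1 - (upper_branch \<beta> h)\<^sup>2) - \<beta> \<noteq> 0"
      using crit_field_deriv_pos upper_branch[OF assms] by (metis less_irrefl)
  qed (use assms upper_branch(4) isCont_upper_branch in auto)
qed

text \<open>On \<open>(0, 1)\<close> a nonnegative field is attained only on the upper branch, since \<open>crit_field \<beta>\<close> is
  negative up to the spinodal point.\<close>

lemma crit_field_compare_upper_branch:
  assumes "0 \<le> h" "0 < z" "z < 1"
  shows "crit_field \<beta> z < h \<longleftrightarrow> z < upper_branch \<beta> h"
    and "crit_field \<beta> z = h \<longleftrightarrow> z = upper_branch \<beta> h"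
proof -
  have h: "- cw_spinodal \<beta> < h"
    using assms cw_spinodal_pos by simp
  note Z = upper_branch[OF h]
  have *: "crit_field \<beta> z < h" if "z < upper_branch \<beta> h"
  proof (cases "z \<le> spinodal_point \<beta>")
    case True
    then show ?thesis
      using crit_field_decreasing[of 0 z] assms spinodal_point_bounds by simp
  next
    case False
    then show ?thesis
      using crit_field_increasing[of z "upper_branch \<beta> h"] that Z by simp
  qed
  have **: "h < crit_field \<beta> z" if "upper_branch \<beta> h < z"
    using crit_field_increasing[of "upper_branch \<beta> h" z] that Z assms by simp
  show "crit_field \<beta> z < h \<longleftrightarrow> z < upper_branch \<beta> h" "crit_field \<beta> z = h \<longleftrightarrow> z = upper_branch \<beta> h"
    using * ** Z(4) by (cases z "upper_branch \<beta> h" rule: linorder_cases; force)+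
qed

text \<open>The positive solution of \<open>m = tanh (\<beta> * m)\<close> is the upper branch at zero field.\<close>

lemma mag_equation_iff: "0 < m \<and> m = tanh (\<beta> * m) \<longleftrightarrow> m = upper_branch \<beta> 0"
proof -
  have h: "- cw_spinodal \<beta> < 0"
    using cw_spinodal_pos by simp
  show ?thesis
  proof
    assume m: "0 < m \<and> m = tanh (\<beta> * m)"
    then have "m < 1"
      using tanh_real_lt_1[of "\<beta> * m"] by linarith
    then show "m = upper_branch \<beta> 0"
      using m crit_field_compare_upper_branch(2)[of 0 m] crit_field_eq_iff[of m \<beta> 0] by simp
  next
    assume "m = upper_branch \<beta> 0"
    then show "0 < m \<and> m = tanh (\<beta> * m)"
      using upper_branch[OF h] crit_field_eq_iff[of m \<beta> 0] by simp
  qed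
qed

lemma cw_mag_eq: "cw_mag \<beta> = upper_branch \<beta> 0"
  by (simp add: cw_mag_def mag_equation_iff)


section \<open>Maximizers of the rate\<close>

lemma mean_field_strict_max_pos:
  assumes "0 \<le> h" "0 \<le> y" "y \<noteq> upper_branch \<beta> h"
  shows "mean_field \<beta> h y < mean_field \<beta> h (upper_branch \<beta> h)"
proof -
  let ?z = "upper_branch \<beta> h"
  have h: "- cw_spinodal \<beta> < h"
    using assms cw_spinodal_pos by simp
  note Z = upper_branch[OF h]
  have cont: "continuous_on S (mean_field \<beta> h)" for S
    using mean_field_has_derivative[of \<beta> h]
    by (meson DERIV_isCont continuous_at_imp_continuous_on)
  consider "y < ?z" | "?z < y"
    using assms by linarith
  then show ?thesis
  proof cases
    case 1
    have "x < tanh (\<beta> * x + h)" if "y < x" "x < ?z" for x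
      using crit_field_compare_upper_branch(1)[of h x] crit_field_less_iff[of x \<beta> h] that Z assms
      by auto
    then show ?thesis
      using mean_field_has_derivative[of \<beta> h] beta cont
      by (intro DERIV_pos_imp_increasing_open[OF 1]) (auto intro!: exI mult_pos_pos)
  next
    case 2
    have "tanh (\<beta> * x + h) < x" if "?z < x" for x
    proof (cases "x < 1")
      case True
      then show ?thesis
        using crit_field_compare_upper_branch[of h x] crit_field_iff[of x \<beta> h] that Z assms
        by (auto simp: not_less_iff_gr_or_eq)
    next
      case False
      then show ?thesis using tanh_real_lt_1[of "\<beta> * x + h"] by linarith
    qed
    then show ?thesis
      using mean_field_has_derivative[of \<beta> h] beta cont
      by (intro DERIV_neg_imp_decreasing_open[OF 2]) (auto intro!: exI mult_pos_neg)
  qed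
qed

lemma mean_field_neg_less:
  assumes "0 < h" "y < 0"
  shows "mean_field \<beta> h y < mean_field \<beta> h (- y)"
proof -
  have "\<bar>\<beta> * y + h\<bar> < - (\<beta> * y) + h"
    using assms beta by (auto simp: abs_less_iff mult_less_0_iff)
  then have "cosh \<bar>\<beta> * y + h\<bar> < cosh (- (\<beta> * y) + h)"
    by (intro cosh_real_strict_mono) auto
  then show ?thesis
    by (simp add: mean_field_def)
qed

lemma mean_field_le_max:
  assumes "0 \<le> h"
  shows "mean_field \<beta> h y \<le> mean_field \<beta> h (upper_branch \<beta> h)"
    and "mean_field \<beta> h y = mean_field \<beta> h (upper_branch \<beta> h) \<Longrightarrow>
      y = upper_branch \<beta> h \<or> h = 0 \<and> y = - upper_branch \<beta> h"
proof -
  have pos: "mean_field \<beta> h x \<le> mean_field \<beta> h (upper_branch \<beta> h)" if "0 \<le> x" for x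
    using mean_field_strict_max_pos[OF assms that] by (cases "x = upper_branch \<beta> h") auto
  have refl: "mean_field \<beta> h y \<le> mean_field \<beta> h (- y)" if "y < 0"
    using mean_field_neg_less[of h y] that assms mean_field_minus[of \<beta> 0 y]
    by (cases "h = 0") auto
  show "mean_field \<beta> h y \<le> mean_field \<beta> h (upper_branch \<beta> h)"
    using pos[of y] pos[of "- y"] refl by (cases "y < 0") auto
  assume eq: "mean_field \<beta> h y = mean_field \<beta> h (upper_branch \<beta> h)"
  show "y = upper_branch \<beta> h \<or> h = 0 \<and> y = - upper_branch \<beta> h"
  proof (cases "0 \<le> y")
    case True
    then show ?thesis using mean_field_strict_max_pos[OF assms True] eq by auto
  next
    case False
    then have "h = 0"
      using mean_field_neg_less[of h y] pos[of "- y"] eq assms by force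
    moreover have "- y = upper_branch \<beta> h"
      using mean_field_strict_max_pos[OF assms, of "- y"] refl eq False by force
    ultimately show ?thesis by auto
  qed
qed

lemma upper_branch_tanh:
  assumes "- cw_spinodal \<beta> < h"
  shows "upper_branch \<beta> h = tanh (\<beta> * upper_branch \<beta> h + h)"
  using upper_branch[OF assms] crit_field_eq_iff[of "upper_branch \<beta> h"] by auto

lemma arg_max_mean_rate_nonneg:
  assumes "0 \<le> h"
  shows "is_arg_max (mean_rate \<beta> h) (\<lambda>z. z \<in> {-1..1}) z \<longleftrightarrow>
    z = upper_branch \<beta> h \<or> h = 0 \<and> z = - upper_branch \<beta> h"
proof -
  let ?z = "upper_branch \<beta> h"
  have h: "- cw_spinodal \<beta> < h"
    using assms cw_spinodal_pos by simp
  have z: "?z \<in> {-1..1}"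
    using upper_branch[OF h] by auto
  have top: "mean_rate \<beta> h ?z = mean_field \<beta> h ?z"
    using mean_rate_le_mean_field(2)[OF z] upper_branch_tanh[OF h] by blast
  have le: "mean_rate \<beta> h y \<le> mean_rate \<beta> h ?z" if "y \<in> {-1..1}" for y
    using mean_rate_le_mean_field(1)[OF that] mean_field_le_max(1)[OF assms] top
    by (metis order_trans)
  have "z = ?z \<or> h = 0 \<and> z = - ?z" if "z \<in> {-1..1}" "mean_rate \<beta> h z = mean_rate \<beta> h ?z"
  proof -
    have "mean_field \<beta> h z = mean_field \<beta> h ?z"
      using mean_rate_le_mean_field(1)[OF that(1), of \<beta> h] mean_field_le_max(1)[OF assms, of z]
        top that(2) by linarith
    then show ?thesis
      by (rule mean_field_le_max(2)[OF assms])
  qed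
  moreover have "mean_rate \<beta> h (- ?z) = mean_rate \<beta> h ?z" if "h = 0"
    using mean_rate_minus[of \<beta> 0 ?z] that by simp
  ultimately show ?thesis
    using le z by (auto simp: is_arg_max_linorder intro: antisym)
qed

lemma arg_max_mean_rate:
  assumes "h \<noteq> 0"
  shows "is_arg_max (mean_rate \<beta> h) (\<lambda>z. z \<in> {-1..1}) z \<longleftrightarrow> z = field_value \<beta> h"
proof (cases "0 < h")
  case True
  then show ?thesis
    using arg_max_mean_rate_nonneg[of h z] by (simp add: field_value_def)
next
  case False
  then show ?thesis
    using arg_max_mean_rate_nonneg[of "- h" "- z"] arg_max_mean_rate_minus[of \<beta> h z] assms
    by (auto simp: field_value_def)
qed

lemma cw_value_eq: "h \<noteq> 0 \<Longrightarrow> cw_value \<beta> h = field_value \<beta> h"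
  by (simp add: cw_value_def cw_equilibrium_values_eq arg_max_mean_rate del: atLeastAtMost_iff)

lemma field_value_pos:
  assumes "0 < h"
  shows "field_value \<beta> h \<in> {cw_mag \<beta><..<1}" "0 < field_value \<beta> h"
  using upper_branch[of h] upper_branch_strict_mono[of 0 h] assms
    cw_spinodal_pos by (auto simp: field_value_def cw_mag_eq)

lemma field_value_tanh: "h \<noteq> 0 \<Longrightarrow> field_value \<beta> h = tanh (\<beta> * field_value \<beta> h + h)"
proof (cases "0 < h")
  case True
  then show ?thesis
    using upper_branch_tanh[of h] cw_spinodal_pos by (simp add: field_value_def)
next
  case False
  assume "h \<noteq> 0"
  with False show ?thesis
    using upper_branch_tanh[of "- h"] cw_spinodal_pos
      tanh_minus[of "\<beta> * upper_branch \<beta> (- h) - h"]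
    by (simp add: field_value_def del: tanh_minus)
qed

end

section \<open>The nonlinear pressure\<close>

lemma sum_exp_sum_list:
  fixes g :: "'a::finite \<Rightarrow> real"
  shows "(\<Sum>xs\<in>{xs. length xs = n}. exp (sum_list (map g xs))) = (\<Sum>s\<in>UNIV. exp (g s)) ^ n"
proof (induction n)
  case (Suc n)
  have "{xs :: 'a list. length xs = Suc n} = (\<lambda>(x, xs). x # xs) ` (UNIV \<times> {xs. length xs = n})"
    by (auto simp: length_Suc_conv)
  then have "(\<Sum>xs\<in>{xs. length xs = Suc n}. exp (sum_list (map g xs)))
      = (\<Sum>(x, xs)\<in>UNIV \<times> {xs. length xs = n}. exp (g x) * exp (sum_list (map g xs)))"
    by (simp add: sum.reindex inj_on_def exp_add case_prod_unfold)
  also have "\<dots> = (\<Sum>x\<in>UNIV. exp (g x)) * (\<Sum>xs\<in>{xs. length xs = n}. exp (sum_list (map g xs)))"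
    by (simp add: sum_product sum.cartesian_product)
  finally show ?case
    using Suc by simp
qed simp

lemma paths_full_map: "paths full_map n = (\<lambda>(s, xs). s # xs) ` (UNIV \<times> {xs. length xs = n})"
  by (auto simp: paths_def full_map_def length_Suc_conv)

lemma sum_paths_full_map:
  "(\<Sum>xs\<in>paths full_map n. f xs) = (\<Sum>s\<in>UNIV. \<Sum>xs\<in>{xs. length xs = n}. f (s # xs))"
  unfolding paths_full_map
  by (subst sum.reindex) (auto simp: inj_on_def sum.cartesian_product case_prod_unfold)

text \<open>The mean of the spins of a path, the initial one excluded.\<close>

definition path_mean :: "nat \<Rightarrow> spin list \<Rightarrow> real"
  where "path_mean n xs = edge_integral full_map spin_obs (empirical n xs)"

lemma path_mean_Cons:
  assumes "length xs = n"
  shows "path_mean n (s # xs) = sum_list (map spin_val xs) / real n"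
proof -
  let ?e = "\<lambda>j. ((s # xs) ! j, (s # xs) ! Suc j)"
  have "spin_obs e * (real (card {j. j < n \<and> ?e j = e}) / real n)
      = (\<Sum>j<n. if e = ?e j then spin_obs e / real n else 0)" for e
  proof -
    have "{..<n} \<inter> {j. e = ?e j} = {j. j < n \<and> ?e j = e}"
      by auto
    then show ?thesis
      by (simp add: sum.If_cases del: nth_Cons_Suc)
  qed
  then have "path_mean n (s # xs)
      = (\<Sum>e\<in>UNIV. \<Sum>j<n. if e = ?e j then spin_obs e / real n else 0)"
    by (simp add: path_mean_def edge_integral_def graph_of_def full_map_def empirical_def
        del: nth_Cons_Suc)
  also have "\<dots> = (\<Sum>j<n. spin_obs (?e j) / real n)"
    by (subst sum.swap) simp
  also have "\<dots> = sum_list (map spin_val xs) / real n"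
    using assms by (simp add: spin_obs_def sum_list_sum_nth atLeast0LessThan sum_divide_distrib)
  finally show ?thesis .
qed

lemma sum_list_spin_val: "\<exists>k\<le>length xs. sum_list (map spin_val xs) = 2 * real k - real (length xs)"
proof (induction xs)
  case (Cons x xs)
  then obtain k where "k \<le> length xs" "sum_list (map spin_val xs) = 2 * real k - real (length xs)"
    by blast
  then show ?case
    by (cases x) (auto intro: exI[of _ k] exI[of _ "Suc k"])
qed auto

text \<open>
  With the square in the energy replaced by its tangent at \<open>y\<close>, the weight of a path is a product
  over its steps.
\<close>

lemma sum_paths_linearized:
  assumes "0 < n"
  shows "(\<Sum>xs\<in>paths full_map n. exp (real n * (\<beta> * (y * path_mean n xs - y\<^sup>2 / 2) + h * path_mean n xs)))
    = 2 * exp (real n * mean_field \<beta> h y)"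
proof -
  have *: "exp (real n * (\<beta> * (y * path_mean n (s # xs) - y\<^sup>2 / 2) + h * path_mean n (s # xs)))
      = exp (- (real n * (\<beta> / 2 * y\<^sup>2))) * exp (sum_list (map (\<lambda>t. (\<beta> * y + h) * spin_val t) xs))"
    if "length xs = n" for s xs
  proof -
    have "sum_list (map (\<lambda>t. (\<beta> * y + h) * spin_val t) xs) = (\<beta> * y + h) * sum_list (map spin_val xs)"
      by (rule sum_list_const_mult)
    then show ?thesis
      using assms that by (simp add: path_mean_Cons field_simps flip: exp_add)
  qed
  have cosh: "exp (- (\<beta> * y + h)) + exp (\<beta> * y + h) = 2 * cosh (\<beta> * y + h)"
    by (simp add: cosh_def)
  have "(\<Sum>xs\<in>paths full_map n. exp (real n * (\<beta> * (y * path_mean n xs - y\<^sup>2 / 2) + h * path_mean n xs)))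
      = 2 * (exp (- (real n * (\<beta> / 2 * y\<^sup>2))) * (2 * cosh (\<beta> * y + h)) ^ n)"
    unfolding sum_paths_full_map cosh[symmetric]
    by (simp add: * sum_exp_sum_list sum_spin UNIV_spin flip: sum_distrib_left)
  also have "(2 * cosh (\<beta> * y + h)) ^ n = exp (real n * ln (2 * cosh (\<beta> * y + h)))"
    by (simp add: exp_of_nat_mult)
  finally show ?thesis
    by (simp add: mean_field_def algebra_simps flip: exp_add)
qed

lemma finite_pressure_bounds:
  assumes beta: "0 \<le> \<beta>" and n: "0 < n" and max: "\<And>y. mean_field \<beta> h y \<le> mean_field \<beta> h z"
  shows "mean_field \<beta> h z \<le> finite_pressure full_map (cw_energy \<beta> h) n"
    and "finite_pressure full_map (cw_energy \<beta> h) n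
      \<le> mean_field \<beta> h z + ln (2 * (real n + 1)) / real n"
proof -
  let ?m = "path_mean n"
  define lin where "lin y xs = exp (real n * (\<beta> * (y * ?m xs - y\<^sup>2 / 2) + h * ?m xs))" for y xs
  define S where "S = (\<Sum>xs\<in>paths full_map n. exp (real n * cw_energy \<beta> h (empirical n xs)))"
  have energy: "cw_energy \<beta> h (empirical n xs) = \<beta> / 2 * (?m xs)\<^sup>2 + h * ?m xs" for xs
    by (simp add: cw_energy_def path_mean_def)
  have lin: "(\<Sum>xs\<in>paths full_map n. lin y xs) = 2 * exp (real n * mean_field \<beta> h y)" for y
    unfolding lin_def by (rule sum_paths_linearized[OF n])
  have fp: "finite_pressure full_map (cw_energy \<beta> h) n = ln S / real n"
    by (simp add: finite_pressure_def S_def)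
  have "\<beta> * (y * m - y\<^sup>2 / 2) \<le> \<beta> / 2 * m\<^sup>2" for y m :: real
  proof -
    have "\<beta> / 2 * m\<^sup>2 - \<beta> * (y * m - y\<^sup>2 / 2) = \<beta> / 2 * (m - y)\<^sup>2"
      by (simp add: power2_eq_square algebra_simps)
    also have "0 \<le> \<dots>"
      using beta by simp
    finally show ?thesis
      by (simp only: diff_ge_0_iff_ge)
  qed
  then have "lin z xs \<le> exp (real n * cw_energy \<beta> h (empirical n xs))" for xs
    by (simp add: lin_def energy mult_left_mono)
  then have "2 * exp (real n * mean_field \<beta> h z) \<le> S"
    unfolding S_def lin[symmetric] by (rule sum_mono)
  then have lower: "exp (real n * mean_field \<beta> h z) \<le> S"
    using exp_gt_zero[of "real n * mean_field \<beta> h z"] by linarith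
  then have "0 < S"
    using exp_gt_zero less_le_trans by blast
  from lower this have "real n * mean_field \<beta> h z \<le> ln S"
    by (simp add: ln_ge_iff)
  then show "mean_field \<beta> h z \<le> finite_pressure full_map (cw_energy \<beta> h) n"
    unfolding fp using n by (simp add: field_simps)

  \<comment> \<open>The mean of a path takes only the values \<open>y k\<close>, at which the linearization is exact.\<close>
  define y where "y k = (2 * real k - real n) / real n" for k
  have "exp (real n * cw_energy \<beta> h (empirical n xs)) \<le> (\<Sum>k\<le>n. lin (y k) xs)"
    if xs: "xs \<in> paths full_map n" for xs
  proof -
    obtain k where k: "k \<le> n" "?m xs = y k"
      using xs sum_list_spin_val unfolding paths_full_map y_def
      by (fastforce simp: path_mean_Cons)
    have "exp (real n * cw_energy \<beta> h (empirical n xs)) = lin (y k) xs"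
      by (simp add: lin_def energy k power2_eq_square)
    also have "\<dots> \<le> (\<Sum>k\<le>n. lin (y k) xs)"
      using k by (intro member_le_sum) (auto simp: lin_def)
    finally show ?thesis .
  qed
  then have "S \<le> (\<Sum>xs\<in>paths full_map n. \<Sum>k\<le>n. lin (y k) xs)"
    unfolding S_def by (rule sum_mono)
  also have "\<dots> = (\<Sum>k\<le>n. 2 * exp (real n * mean_field \<beta> h (y k)))"
    by (subst sum.swap) (simp add: lin)
  also have "\<dots> \<le> (\<Sum>k\<le>n. 2 * exp (real n * mean_field \<beta> h z))"
    using max by (intro sum_mono) (simp add: mult_left_mono)
  finally have "S \<le> 2 * (real n + 1) * exp (real n * mean_field \<beta> h z)"
    by (simp add: algebra_simps)
  then have "ln S \<le> ln (2 * (real n + 1) * exp (real n * mean_field \<beta> h z))"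
    using \<open>0 < S\<close> by simp
  then have "ln S \<le> ln (2 * (real n + 1)) + real n * mean_field \<beta> h z"
    by (simp add: ln_mult)
  then show "finite_pressure full_map (cw_energy \<beta> h) n
      \<le> mean_field \<beta> h z + ln (2 * (real n + 1)) / real n"
    unfolding fp using n by (simp add: field_simps)
qed

lemma finite_pressure_tendsto:
  assumes "0 \<le> \<beta>" "\<And>y. mean_field \<beta> h y \<le> mean_field \<beta> h z"
  shows "finite_pressure full_map (cw_energy \<beta> h) \<longlonglongrightarrow> mean_field \<beta> h z"
proof (rule tendsto_sandwich)
  show "\<forall>\<^sub>F n in sequentially. mean_field \<beta> h z \<le> finite_pressure full_map (cw_energy \<beta> h) n"
    "\<forall>\<^sub>F n in sequentially. finite_pressure full_map (cw_energy \<beta> h) n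
      \<le> mean_field \<beta> h z + ln (2 * (real n + 1)) / real n"
    using finite_pressure_bounds[OF assms(1) _ assms(2)]
    by (auto intro!: eventually_sequentiallyI[of 1])
  have "(\<lambda>n. ln (2 * (real n + 1)) / real n) \<longlonglongrightarrow> 0"
    by real_asymp
  then show "(\<lambda>n. mean_field \<beta> h z + ln (2 * (real n + 1)) / real n) \<longlonglongrightarrow> mean_field \<beta> h z"
    using tendsto_add[OF tendsto_const] by fastforce
qed simp

lemma mean_field_max_exists:
  assumes "1 < \<beta>"
  obtains z where "\<And>y. mean_field \<beta> h y \<le> mean_field \<beta> h z"
proof (cases "0 \<le> h")
  case True
  then show ?thesis
    using mean_field_le_max(1)[OF assms] that by blast
next
  case False
  then have "mean_field \<beta> h y \<le> mean_field \<beta> h (- upper_branch \<beta> (- h))" for y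
    using mean_field_le_max(1)[OF assms, of "- h" "- y"] mean_field_minus[of \<beta> "- h"]
      mean_field_minus[of \<beta> h y] by simp
  then show ?thesis
    using that by blast
qed

lemma cw_pressure_eq:
  assumes "0 \<le> \<beta>" "\<And>y. mean_field \<beta> h y \<le> mean_field \<beta> h z"
  shows "cw_pressure \<beta> h = mean_field \<beta> h z"
  unfolding cw_pressure_def nonlinear_pressure_def
  using finite_pressure_tendsto[OF assms] by (rule limI)

lemma convex_ln_cosh: "convex_on UNIV (\<lambda>x::real. ln (2 * cosh x))"
proof (rule f''_ge0_imp_convex)
  show "((\<lambda>x. ln (2 * cosh x)) has_real_derivative tanh x) (at x)" for x :: real
    by (auto intro!: derivative_eq_intros simp: tanh_def)
  show "(tanh has_real_derivative 1 - (tanh x)\<^sup>2) (at x)" for x :: real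
    by (auto intro!: derivative_eq_intros)
  show "0 \<le> 1 - (tanh x)\<^sup>2" for x :: real
    using tanh_real_bounds[of x] by (simp add: abs_square_le_1 abs_le_iff)
qed simp

context
  fixes \<beta> :: real
  assumes beta: "1 < \<beta>"
begin

lemma cw_pressure_nonneg: "0 \<le> h \<Longrightarrow> cw_pressure \<beta> h = mean_field \<beta> h (upper_branch \<beta> h)"
  using beta mean_field_le_max(1)[OF beta] by (intro cw_pressure_eq) auto

lemma cw_pressure_minus: "cw_pressure \<beta> (- h) = cw_pressure \<beta> h"
proof -
  obtain z where z: "\<And>y. mean_field \<beta> h y \<le> mean_field \<beta> h z"
    using mean_field_max_exists[OF beta] by blast
  then have "mean_field \<beta> (- h) y \<le> mean_field \<beta> (- h) (- z)" for y
    using mean_field_minus[of \<beta> h z] mean_field_minus[of \<beta> h "- y"] by simp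
  then show ?thesis
    using beta z cw_pressure_eq[of \<beta> h z] cw_pressure_eq[of \<beta> "- h" "- z"] mean_field_minus[of \<beta> h z]
    by simp
qed

lemma cw_pressure_field_value:
  assumes "h \<noteq> 0"
  shows "cw_pressure \<beta> h = mean_field \<beta> h (field_value \<beta> h)"
  using cw_pressure_nonneg[of h] cw_pressure_nonneg[of "- h"] cw_pressure_minus[of h]
    mean_field_minus[of \<beta> h "field_value \<beta> h"] assms
  by (cases "0 < h") (auto simp: field_value_def)

text \<open>The pressure is a pointwise maximum of convex functions of the field.\<close>

lemma convex_cw_pressure: "convex_on UNIV (cw_pressure \<beta>)"
proof (rule convex_onI)
  fix t h k :: real
  assume t: "0 < t" "t < 1"
  have le: "mean_field \<beta> h y \<le> cw_pressure \<beta> h" for h y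
    using mean_field_max_exists[OF beta, of h] cw_pressure_eq[of \<beta> h] beta
    by (metis less_eq_real_def order.strict_trans zero_less_one)
  obtain z where z: "cw_pressure \<beta> ((1 - t) *\<^sub>R h + t *\<^sub>R k)
      = mean_field \<beta> ((1 - t) *\<^sub>R h + t *\<^sub>R k) z"
    using mean_field_max_exists[OF beta] cw_pressure_eq beta
    by (metis less_eq_real_def order.strict_trans zero_less_one)
  have "ln (2 * cosh ((1 - t) *\<^sub>R (\<beta> * z + h) + t *\<^sub>R (\<beta> * z + k)))
      \<le> (1 - t) * ln (2 * cosh (\<beta> * z + h)) + t * ln (2 * cosh (\<beta> * z + k))"
    using t by (intro convex_onD[OF convex_ln_cosh]) auto
  moreover have "(1 - t) *\<^sub>R (\<beta> * z + h) + t *\<^sub>R (\<beta> * z + k) = \<beta> * z + ((1 - t) *\<^sub>R h + t *\<^sub>R k)"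
    by (simp add: algebra_simps)
  moreover have "(1 - t) * (a - q) + t * (b - q) = (1 - t) * a + t * b - q" for a b q :: real
    by (simp add: algebra_simps)
  ultimately have "mean_field \<beta> ((1 - t) *\<^sub>R h + t *\<^sub>R k) z
      \<le> (1 - t) * mean_field \<beta> h z + t * mean_field \<beta> k z"
    unfolding mean_field_def by (metis diff_right_mono)
  also have "\<dots> \<le> (1 - t) * cw_pressure \<beta> h + t * cw_pressure \<beta> k"
    using t le by (intro add_mono mult_left_mono) auto
  finally show "cw_pressure \<beta> ((1 - t) *\<^sub>R h + t *\<^sub>R k)
      \<le> (1 - t) * cw_pressure \<beta> h + t * cw_pressure \<beta> k"
    using z by simp
qed auto

text \<open>Envelope theorem along the upper branch, which continues past \<open>h = 0\<close>.\<close>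

lemma mean_field_upper_branch_has_derivative:
  assumes "- cw_spinodal \<beta> < h"
  shows "((\<lambda>k. mean_field \<beta> k (upper_branch \<beta> k)) has_real_derivative upper_branch \<beta> h) (at h)"
proof -
  let ?Z = "upper_branch \<beta>"
  obtain D where D: "(?Z has_real_derivative D) (at h)"
    using upper_branch_has_derivative[OF beta assms] by blast
  have "((\<lambda>k. ln (2 * cosh (\<beta> * ?Z k + k)) - \<beta> / 2 * (?Z k)\<^sup>2) has_real_derivative
      tanh (\<beta> * ?Z h + h) * (\<beta> * D + 1) - \<beta> * ?Z h * D) (at h)"
    by (rule derivative_eq_intros refl D | simp add: tanh_def field_simps)+
  also have "tanh (\<beta> * ?Z h + h) * (\<beta> * D + 1) - \<beta> * ?Z h * D = ?Z h"
    using upper_branch_tanh[OF beta assms] by (simp add: algebra_simps)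
  finally show ?thesis
    by (simp add: mean_field_def)
qed

lemma cw_pressure_derivative_right: "(cw_pressure \<beta> has_real_derivative cw_mag \<beta>) (at_right 0)"
proof -
  have "((\<lambda>k. mean_field \<beta> k (upper_branch \<beta> k)) has_real_derivative upper_branch \<beta> 0)
      (at 0 within {0..})"
    using mean_field_upper_branch_has_derivative[of 0] cw_spinodal_pos[OF beta]
    by (auto intro: has_field_derivative_at_within)
  then have "(cw_pressure \<beta> has_real_derivative upper_branch \<beta> 0) (at 0 within {0..})"
    by (rule has_field_derivative_transform_within[of _ _ _ _ 1]) (auto simp: cw_pressure_nonneg)
  then show ?thesis
    by (simp add: cw_mag_eq[OF beta] at_within_Ici_at_right)
qed

end

section \<open>Real analyticity of the pressure\<close>

lemma real_analytic_on_if_holomorphic: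
  assumes "\<And>x. x \<in> S \<Longrightarrow> \<exists>r>0. \<exists>F. F holomorphic_on ball (of_real x) r \<and>
    (\<forall>y. \<bar>y - x\<bar> < r \<longrightarrow> f y = Re (F (of_real y)))"
  shows "real_analytic_on f S"
  unfolding real_analytic_on_def
proof
  fix x assume "x \<in> S"
  then obtain r F where r: "0 < r" and F: "F holomorphic_on ball (of_real x) r"
    and f: "\<And>y. \<bar>y - x\<bar> < r \<Longrightarrow> f y = Re (F (of_real y))"
    using assms by blast
  define a where "a n = Re ((deriv ^^ n) F (of_real x) / fact n)" for n
  have "(\<lambda>n. a n * (y - x) ^ n) sums f y" if y: "\<bar>y - x\<bar> < r" for y
  proof -
    have "of_real y \<in> ball (of_real x :: complex) r"
      using y by (simp add: dist_real_def abs_minus_commute)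
    then have "(\<lambda>n. (deriv ^^ n) F (of_real x) / fact n * (of_real y - of_real x) ^ n) sums F (of_real y)"
      by (rule holomorphic_power_series[OF F])
    then have "(\<lambda>n. Re ((deriv ^^ n) F (of_real x) / fact n * (of_real y - of_real x) ^ n))
        sums Re (F (of_real y))"
      by (rule sums_Re)
    moreover have "Re (c * (of_real y - of_real x) ^ n) = Re c * (y - x) ^ n" for c n
    proof -
      have "(of_real y - of_real x :: complex) ^ n = of_real ((y - x) ^ n)"
        by simp
      then show ?thesis
        by (simp del: of_real_power of_real_diff)
    qed
    ultimately show ?thesis
      by (simp only: a_def f[OF y])
  qed
  then show "\<exists>r>0. \<exists>a. \<forall>y. \<bar>y - x\<bar> < r \<longrightarrow> (\<lambda>n. a n * (y - x) ^ n) sums f y"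
    using r by blast
qed

lemma real_analytic_on_reflect:
  assumes "real_analytic_on f S" "\<And>x. f (- x) = f x"
  shows "real_analytic_on f (uminus ` S)"
  unfolding real_analytic_on_def
proof
  fix x assume "x \<in> uminus ` S"
  then obtain r a where r: "0 < r" and a: "\<And>y. \<bar>y - (- x)\<bar> < r \<Longrightarrow> (\<lambda>n. a n * (y - (- x)) ^ n) sums f y"
    using assms(1) by (fastforce simp: real_analytic_on_def)
  have "(\<lambda>n. ((- 1) ^ n * a n) * (y - x) ^ n) sums f y" if "\<bar>y - x\<bar> < r" for y
  proof -
    have "(- y - (- x)) ^ n = (- 1) ^ n * (y - x) ^ n" for n
      by (metis minus_diff_minus mult_minus1 power_mult_distrib)
    then show ?thesis
      using a[of "- y"] that assms(2)[of y] by (simp add: abs_minus_commute algebra_simps)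
  qed
  then show "\<exists>r>0. \<exists>a. \<forall>y. \<bar>y - x\<bar> < r \<longrightarrow> (\<lambda>n. a n * (y - x) ^ n) sums f y"
    using r by (intro exI[of _ r] conjI exI[of _ "\<lambda>n. (- 1) ^ n * a n"]) auto
qed

context
  fixes \<beta> :: real
  assumes beta: "1 < \<beta>"
begin

text \<open>
  In the variable \<open>w = \<beta> * z + h\<close> the critical-point equation \<open>z = tanh (\<beta> * z + h)\<close> reads
  \<open>h = w - \<beta> * tanh w\<close>, whose right-hand side is holomorphic near the real axis. Its local inverse
  extends \<open>w\<close>, and with it the pressure, to complex fields.
\<close>

lemma mean_field_upper_branch_holomorphic:
  assumes h: "- cw_spinodal \<beta> < h"
  shows "\<exists>r>0. \<exists>F. F holomorphic_on ball (of_real h) r \<and>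
    (\<forall>k. \<bar>k - h\<bar> < r \<longrightarrow> mean_field \<beta> k (upper_branch \<beta> k) = Re (F (of_real k)))"
proof -
  define W where "W k = \<beta> * upper_branch \<beta> k + k" for k
  define K where "K w = w - of_real \<beta> * tanh w" for w :: complex
  define G where "G w = Ln (2 * cosh w) - of_real \<beta> / 2 * (tanh w)\<^sup>2" for w :: complex
  define U where "U = {w :: complex. 0 < Re (cosh w)}"
  have of_real_tanh: "tanh (of_real x :: complex) = of_real (tanh x)" for x :: real
    by (simp add: tanh_def sinh_def cosh_def exp_of_real scaleR_conv_of_real flip: of_real_minus)
  have of_real_cosh: "cosh (of_real x :: complex) = of_real (cosh x)" for x :: real
    by (simp add: cosh_def exp_of_real scaleR_conv_of_real flip: of_real_minus)
  have U: "open U" "of_real x \<in> U" for x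
    unfolding U_def by (auto intro!: open_Collect_less continuous_intros simp: of_real_cosh)
  have nz: "cosh w \<noteq> 0" if "w \<in> U" for w
    using that by (auto simp: U_def)
  have K_deriv: "(K has_field_derivative 1 - of_real \<beta> * (1 - (tanh w)\<^sup>2)) (at w)" if "w \<in> U" for w
    unfolding K_def using nz[OF that] by (auto intro!: derivative_eq_intros)
  then have K_hol: "K holomorphic_on U"
    using U(1) by (auto simp: holomorphic_on_open)
  have "2 * cosh w \<notin> \<real>\<^sub>\<le>\<^sub>0" if "w \<in> U" for w
    using that by (auto simp: U_def complex_nonpos_Reals_iff)
  then have G_hol: "G holomorphic_on U"
    unfolding G_def tanh_def sinh_def cosh_def using nz
    by (auto intro!: holomorphic_intros simp: cosh_def)
  have tanh_W: "tanh (W k) = upper_branch \<beta> k" if "- cw_spinodal \<beta> < k" for k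
    using upper_branch_tanh[OF beta that] by (simp add: W_def)
  have K_W: "K (of_real (W k)) = of_real k"
    and G_W: "mean_field \<beta> k (upper_branch \<beta> k) = Re (G (of_real (W k)))"
    if k: "- cw_spinodal \<beta> < k" for k
  proof -
    have "K (of_real (W k)) = of_real (W k - \<beta> * upper_branch \<beta> k)"
      by (simp add: K_def of_real_tanh tanh_W[OF k])
    then show "K (of_real (W k)) = of_real k"
      by (simp add: W_def)
    have "G (of_real (W k)) = of_real (mean_field \<beta> k (upper_branch \<beta> k))"
      using Ln_of_real[of "2 * cosh (W k)"]
      by (simp add: G_def of_real_tanh of_real_cosh tanh_W[OF k] mean_field_def) (simp add: W_def)
    then show "mean_field \<beta> k (upper_branch \<beta> k) = Re (G (of_real (W k)))"
      by simp
  qed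
  have "1 - \<beta> * (1 - (upper_branch \<beta> h)\<^sup>2) \<noteq> 0"
  proof -
    have "(upper_branch \<beta> h)\<^sup>2 < 1"
      using upper_branch[OF beta h] by (simp add: power_less_one_iff)
    then show ?thesis
      using crit_field_deriv_pos[OF beta upper_branch(1,2)[OF beta h]] by (simp add: field_simps)
  qed
  moreover have "deriv K (of_real (W h)) = of_real (1 - \<beta> * (1 - (upper_branch \<beta> h)\<^sup>2))"
    using DERIV_imp_deriv[OF K_deriv[OF U(2)]] by (simp add: of_real_tanh tanh_W[OF h])
  ultimately have "deriv K (of_real (W h)) \<noteq> 0"
    by (metis of_real_eq_0_iff)
  then obtain \<rho> where rho: "0 < \<rho>" "ball (of_real (W h)) \<rho> \<subseteq> U" "open (K ` ball (of_real (W h)) \<rho>)"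
      "inj_on K (ball (of_real (W h)) \<rho>)"
    using has_complex_derivative_locally_invertible[OF K_hol U(2) U(1)] by metis
  let ?B = "ball (of_real (W h) :: complex) \<rho>"
  have "K holomorphic_on ?B"
    using K_hol rho(2) by (rule holomorphic_on_subset)
  then obtain g where g: "g holomorphic_on (K ` ?B)" "\<And>w. w \<in> ?B \<Longrightarrow> g (K w) = w"
    using holomorphic_has_inverse[of K ?B] rho(4) by (metis open_ball)
  have "of_real h \<in> K ` ?B"
    using K_W[OF h] rho(1) by (metis centre_in_ball imageI)
  then obtain r1 where r1: "0 < r1" "ball (of_real h) r1 \<subseteq> K ` ?B"
    using rho(3) open_contains_ball by blast
  have "isCont W h"
    unfolding W_def using isCont_upper_branch[OF beta h] by (intro continuous_intros)
  then obtain r2 where r2: "0 < r2" "\<And>k. \<bar>k - h\<bar> < r2 \<Longrightarrow> \<bar>W k - W h\<bar> < \<rho>"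
    using rho(1) unfolding continuous_at_eps_delta by (metis dist_real_def)
  define r where "r = min (min r1 r2) (h + cw_spinodal \<beta>)"
  have "(G \<circ> g) holomorphic_on ball (of_real h) r"
  proof (rule holomorphic_on_compose_gen)
    show "g holomorphic_on ball (of_real h) r"
      using r1(2) by (intro holomorphic_on_subset[OF g(1)]) (auto simp: r_def)
    have "g w \<in> ?B" if "w \<in> K ` ?B" for w
      using g(2) that by auto
    then show "g ` ball (of_real h) r \<subseteq> U"
      using r1(2) rho(2) by (force simp: r_def)
  qed (rule G_hol)
  moreover have "mean_field \<beta> k (upper_branch \<beta> k) = Re ((G \<circ> g) (of_real k))" if "\<bar>k - h\<bar> < r" for k
  proof -
    have k: "- cw_spinodal \<beta> < k" "\<bar>W k - W h\<bar> < \<rho>"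
      using that r2 by (auto simp: r_def)
    have "of_real (W k) \<in> ?B"
      using k(2) by (simp add: dist_real_def abs_minus_commute)
    then have "g (of_real k) = of_real (W k)"
      using g(2) K_W[OF k(1)] by metis
    then show ?thesis
      using G_W[OF k(1)] by simp
  qed
  moreover have "0 < r"
    using r1 r2 h by (auto simp: r_def)
  ultimately show ?thesis
    by blast
qed

lemma real_analytic_cw_pressure_pos: "real_analytic_on (cw_pressure \<beta>) {0<..}"
proof (rule real_analytic_on_if_holomorphic)
  fix h :: real assume "h \<in> {0<..}"
  then have h: "0 < h" "- cw_spinodal \<beta> < h"
    using cw_spinodal_pos[OF beta] by auto
  obtain r F where r: "0 < r" "F holomorphic_on ball (of_real h) r"
      "\<And>k. \<bar>k - h\<bar> < r \<Longrightarrow> mean_field \<beta> k (upper_branch \<beta> k) = Re (F (of_real k))"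
    using mean_field_upper_branch_holomorphic[OF h(2)] by blast
  have "F holomorphic_on ball (of_real h) (min r h)"
    using r(2) by (rule holomorphic_on_subset) auto
  moreover have "cw_pressure \<beta> k = Re (F (of_real k))" if "\<bar>k - h\<bar> < min r h" for k
    using that r(3)[of k] cw_pressure_nonneg[OF beta, of k] by auto
  ultimately show "\<exists>r>0. \<exists>F. F holomorphic_on ball (of_real h) r \<and>
      (\<forall>k. \<bar>k - h\<bar> < r \<longrightarrow> cw_pressure \<beta> k = Re (F (of_real k)))"
    using r(1) h(1) by (intro exI[of _ "min r h"]) auto
qed

lemma real_analytic_cw_pressure_neg: "real_analytic_on (cw_pressure \<beta>) {..<0}"
proof -
  have "uminus ` {0<..} = {..<0 :: real}"
    by simp
  then show ?thesis
    using real_analytic_on_reflect[OF real_analytic_cw_pressure_pos cw_pressure_minus[OF beta]] by metis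
qed

end

section \<open>Critical points and metastability\<close>

lemma binent_has_derivative:
  assumes "\<bar>z\<bar> < 1"
  shows "(binent has_real_derivative - artanh z) (at z)"
proof -
  have z: "0 < 1 + z" "0 < 1 - z"
    using assms by auto
  have xlnx: "((\<lambda>x. x * ln x) has_real_derivative ln x + 1) (at x)" if "0 < x" for x :: real
    using that by (auto intro!: derivative_eq_intros)
  have "((\<lambda>z. (1 + z) / 2 * ln ((1 + z) / 2)) has_real_derivative (ln ((1 + z) / 2) + 1) * (1 / 2)) (at z)"
    using z by (intro DERIV_chain2[OF xlnx]) (auto intro!: derivative_eq_intros)
  moreover have "((\<lambda>z. (1 - z) / 2 * ln ((1 - z) / 2)) has_real_derivative (ln ((1 - z) / 2) + 1) * (- 1 / 2)) (at z)"
    using z by (intro DERIV_chain2[OF xlnx]) (auto intro!: derivative_eq_intros)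
  ultimately have "(binent has_real_derivative
      - ((ln ((1 + z) / 2) + 1) * (1 / 2)) - (ln ((1 - z) / 2) + 1) * (- 1 / 2)) (at z)"
    unfolding binent_def[abs_def] by (intro DERIV_diff DERIV_minus)
  also have "- ((ln ((1 + z) / 2) + 1) * (1 / 2)) - (ln ((1 - z) / 2) + 1) * (- 1 / 2) = - artanh z"
    using z by (simp add: artanh_def ln_div field_simps)
  finally show ?thesis .
qed

lemma cw_rate_has_derivative:
  assumes "\<bar>z\<bar> < 1"
  shows "(cw_rate \<beta> h has_real_derivative h - crit_field \<beta> z) (at z)"
proof -
  have "(mean_rate \<beta> h has_real_derivative h - crit_field \<beta> z) (at z)"
    unfolding mean_rate_def[abs_def] using binent_has_derivative[OF assms]
    by (auto intro!: derivative_eq_intros simp: crit_field_def)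
  then show ?thesis
    by (rule has_field_derivative_transform_within_open[where S = "{-1<..<1}"])
      (use assms in \<open>auto simp: cw_rate_eq\<close>)
qed

lemma critical_points_cw_rate:
  "critical_points_in {-1<..<1} (cw_rate \<beta> h) = {z \<in> {-1<..<1}. crit_field \<beta> z = h}"
proof -
  have "(cw_rate \<beta> h has_real_derivative 0) (at z) \<longleftrightarrow> crit_field \<beta> z = h" if "\<bar>z\<bar> < 1" for z
    using cw_rate_has_derivative[OF that, of \<beta> h] DERIV_unique by fastforce
  then show ?thesis
    by (auto simp: critical_points_in_def abs_less_iff)
qed

lemma cw_rate_minus: "z \<in> {-1..1} \<Longrightarrow> cw_rate \<beta> (- h) (- z) = cw_rate \<beta> h z"
  by (simp add: cw_rate_eq mean_rate_minus)

text \<open>The filters in the notions of local extremum, unfolded into distances.\<close>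

lemma strict_local_max_onD:
  assumes "strict_local_max_on S f x"
  obtains d where "0 < d" "x \<in> S" "\<And>y. y \<in> S \<Longrightarrow> y \<noteq> x \<Longrightarrow> \<bar>y - x\<bar> < d \<Longrightarrow> f y < f x"
  using assms by (auto simp: strict_local_max_on_def eventually_at dist_real_def)

lemma local_min_onD:
  assumes "local_min_on S f x"
  obtains d where "0 < d" "x \<in> S" "\<And>y. y \<in> S \<Longrightarrow> y \<noteq> x \<Longrightarrow> \<bar>y - x\<bar> < d \<Longrightarrow> f x \<le> f y"
  using assms by (auto simp: local_min_on_def eventually_at dist_real_def)

lemma unique_maximizer_cw_rate_iff:
  "unique_maximizer_on {-1..1} (cw_rate \<beta> h) x \<longleftrightarrow>
    (\<forall>y. is_arg_max (mean_rate \<beta> h) (\<lambda>z. z \<in> {-1..1}) y \<longleftrightarrow> y = x)"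
proof -
  have "is_arg_max (cw_rate \<beta> h) (\<lambda>z. z \<in> {-1..1}) y
      \<longleftrightarrow> is_arg_max (mean_rate \<beta> h) (\<lambda>z. z \<in> {-1..1}) y" for y
    unfolding is_arg_max_linorder by (metis cw_rate_eq)
  then show ?thesis
    by (simp add: unique_maximizer_on_def)
qed

lemma cw_metastable_reflect:
  assumes "cw_metastable \<beta> h zg zl zm"
  shows "cw_metastable \<beta> (- h) (- zg) (- zl) (- zm)"
proof -
  have un: "unique_maximizer_on {-1..1} (cw_rate \<beta> h) zg"
    and max: "strict_local_max_on {-1..1} (cw_rate \<beta> h) zl"
    and min: "local_min_on {-1..1} (cw_rate \<beta> h) zm"
    and ord: "zl * zg < 0" "min zl zg < zm" "zm < max zl zg"
    using assms by (auto simp: cw_metastable_def)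
  have rate: "cw_rate \<beta> (- h) y = cw_rate \<beta> h (- y)" if "y \<in> {-1..1}" for y
    using cw_rate_minus[of "- y" \<beta> h] that by simp
  have "unique_maximizer_on {-1..1} (cw_rate \<beta> (- h)) (- zg)"
    using un arg_max_mean_rate_minus[of \<beta> h] unfolding unique_maximizer_cw_rate_iff
    by (metis minus_minus)
  moreover have "strict_local_max_on {-1..1} (cw_rate \<beta> (- h)) (- zl)"
  proof -
    obtain d where d: "0 < d" "zl \<in> {-1..1}"
      "\<And>y. y \<in> {-1..1} \<Longrightarrow> y \<noteq> zl \<Longrightarrow> \<bar>y - zl\<bar> < d \<Longrightarrow> cw_rate \<beta> h y < cw_rate \<beta> h zl"
      using strict_local_max_onD[OF max] by metis
    have "cw_rate \<beta> (- h) y < cw_rate \<beta> (- h) (- zl)"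
      if "y \<in> {-1..1}" "y \<noteq> - zl" "\<bar>y - - zl\<bar> < d" for y
      using d(3)[of "- y"] that d(2) by (auto simp: rate abs_minus_commute)
    then show ?thesis
      using d(1,2) unfolding strict_local_max_on_def eventually_at dist_real_def by auto
  qed
  moreover have "local_min_on {-1..1} (cw_rate \<beta> (- h)) (- zm)"
  proof -
    obtain d where d: "0 < d" "zm \<in> {-1..1}"
      "\<And>y. y \<in> {-1..1} \<Longrightarrow> y \<noteq> zm \<Longrightarrow> \<bar>y - zm\<bar> < d \<Longrightarrow> cw_rate \<beta> h zm \<le> cw_rate \<beta> h y"
      using local_min_onD[OF min] by metis
    have "cw_rate \<beta> (- h) (- zm) \<le> cw_rate \<beta> (- h) y"
      if "y \<in> {-1..1}" "y \<noteq> - zm" "\<bar>y - - zm\<bar> < d" for y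
      using d(3)[of "- y"] that d(2) by (auto simp: rate abs_minus_commute)
    then show ?thesis
      using d(1,2) unfolding local_min_on_def eventually_at dist_real_def by auto
  qed
  ultimately show ?thesis
    using ord by (auto simp: cw_metastable_def)
qed

text \<open>First-derivative test for a strict maximum over an interval.\<close>

lemma strict_max_on_interval:
  fixes f :: "real \<Rightarrow> real"
  assumes x: "x \<in> {a<..<b}" and der: "\<And>y. y \<in> {a<..<b} \<Longrightarrow> (f has_real_derivative f' y) (at y)"
    and pos: "\<And>y. a < y \<Longrightarrow> y < x \<Longrightarrow> 0 < f' y" and neg: "\<And>y. x < y \<Longrightarrow> y < b \<Longrightarrow> f' y < 0"
    and y: "y \<in> {a<..<b}" "y \<noteq> x"
  shows "f y < f x"
proof -
  have cont: "continuous_on {c..d} f" if "a < c" "d < b" for c d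
    using that by (intro continuous_at_imp_continuous_on ballI DERIV_isCont[OF der]) auto
  consider "y < x" | "x < y"
    using y by linarith
  then show ?thesis
  proof cases
    case 1
    show ?thesis
    proof (rule DERIV_pos_imp_increasing_open[OF 1])
      show "\<exists>D. (f has_real_derivative D) (at t) \<and> 0 < D" if "y < t" "t < x" for t
        using der[of t] pos[of t] that x y by (intro exI[of _ "f' t"]) auto
    qed (use cont x y in auto)
  next
    case 2
    show ?thesis
    proof (rule DERIV_neg_imp_decreasing_open[OF 2])
      show "\<exists>D. (f has_real_derivative D) (at t) \<and> D < 0" if "x < t" "t < y" for t
        using der[of t] neg[of t] that x y by (intro exI[of _ "f' t"]) auto
    qed (use cont x y in auto)
  qed
qed

text \<open>At the endpoint \<open>-1\<close> the entropy has infinite slope, so the rate increases there.\<close>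

lemma cw_rate_not_max_at_minus_one:
  assumes "0 < h"
  shows "\<not> strict_local_max_on {-1..1} (cw_rate \<beta> h) (- 1)"
proof
  assume "strict_local_max_on {-1..1} (cw_rate \<beta> h) (- 1)"
  then obtain d where d: "0 < d"
    "\<And>y. y \<in> {-1..1} \<Longrightarrow> y \<noteq> - 1 \<Longrightarrow> \<bar>y - - 1\<bar> < d \<Longrightarrow> cw_rate \<beta> h y < cw_rate \<beta> h (- 1)"
    by (rule strict_local_max_onD) blast
  \<comment> \<open>Below \<open>exp (- 2 * \<bar>\<beta>\<bar>)\<close> the entropy gain \<open>- u * ln u\<close> outweighs the quadratic loss.\<close>
  define u where "u = min (min (1 / 2) (d / 3)) (exp (- 2 * \<bar>\<beta>\<bar>))"
  have u: "0 < u" "u \<le> 1 / 2" "2 * u < d" "ln u \<le> - 2 * \<bar>\<beta>\<bar>"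
    using d(1) ln_le_cancel_iff[of u "exp (- 2 * \<bar>\<beta>\<bar>)"] by (auto simp: u_def)
  have "binent (2 * u - 1) = - u * ln u - (1 - u) * ln (1 - u)"
  proof -
    have "(1 + (2 * u - 1)) / 2 = u" "(1 - (2 * u - 1)) / 2 = 1 - u"
      by (auto simp: field_simps)
    then show ?thesis
      by (simp only: binent_def mult_minus_left)
  qed
  moreover have "(1 - u) * ln (1 - u) \<le> 0"
    using u by (intro mult_nonneg_nonpos) auto
  moreover have "u * ln u \<le> u * (- 2 * \<bar>\<beta>\<bar>)"
    using u by (intro mult_left_mono) auto
  ultimately have "2 * u * \<bar>\<beta>\<bar> \<le> binent (2 * u - 1)"
    by simp
  moreover have "- (2 * u * \<bar>\<beta>\<bar>) \<le> \<beta> / 2 * ((2 * u - 1)\<^sup>2 - 1)"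
  proof -
    have "\<beta> * (u * (1 - u)) \<le> \<bar>\<beta>\<bar> * (u * 1)"
      using u by (intro mult_mono) auto
    then show ?thesis
      by (simp add: power2_eq_square algebra_simps)
  qed
  ultimately have "0 \<le> binent (2 * u - 1) + \<beta> / 2 * (2 * u - 1)\<^sup>2 - \<beta> / 2"
    by (simp add: right_diff_distrib)
  moreover have "0 < h * (2 * u)"
    using assms u by simp
  moreover have "binent (- 1) = 0"
    by (simp add: binent_def)
  ultimately have "cw_rate \<beta> h (- 1) \<le> cw_rate \<beta> h (2 * u - 1)"
    using u by (simp add: cw_rate_eq mean_rate_def right_diff_distrib)
  then show False
    using d(2)[of "2 * u - 1"] u by simp
qed

context
  fixes \<beta> :: real
  assumes beta: "1 < \<beta>"
begin

lemma unique_maximizer_cw_rate: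
  "h \<noteq> 0 \<Longrightarrow> unique_maximizer_on {-1..1} (cw_rate \<beta> h) z \<longleftrightarrow> z = field_value \<beta> h"
  unfolding unique_maximizer_cw_rate_iff using arg_max_mean_rate[OF beta, of h] by metis

lemma crit_field_minimum:
  assumes "0 \<le> x" "x < 1"
  shows "- cw_spinodal \<beta> \<le> crit_field \<beta> x"
    and "crit_field \<beta> x = - cw_spinodal \<beta> \<longleftrightarrow> x = spinodal_point \<beta>"
  using crit_field_decreasing[OF beta, of x "spinodal_point \<beta>"] spinodal_point_bounds[OF beta]
    crit_field_increasing[OF beta, of "spinodal_point \<beta>" x] assms
  by (cases x "spinodal_point \<beta>" rule: linorder_cases; simp add: cw_spinodal_eq[OF beta])+

text \<open>Apart from the global maximizer, critical points have the sign opposite to the field.\<close>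

lemma crit_field_solutions:
  assumes h: "h \<noteq> 0" and z: "\<bar>z\<bar> < 1"
  shows "crit_field \<beta> z = h \<longleftrightarrow>
    z = field_value \<beta> h \<or> z * h < 0 \<and> crit_field \<beta> \<bar>z\<bar> = - \<bar>h\<bar>"
proof -
  have pos: "crit_field \<beta> z = h \<longleftrightarrow>
      z = field_value \<beta> h \<or> z * h < 0 \<and> crit_field \<beta> \<bar>z\<bar> = - \<bar>h\<bar>"
    if "0 < h" "\<bar>z\<bar> < 1" for h z
  proof (cases "0 < z")
    case True
    then show ?thesis
      using crit_field_compare_upper_branch(2)[OF beta, of h z] that
      by (auto simp: field_value_def mult_less_0_iff)
  next
    case False
    then have "z \<noteq> field_value \<beta> h"
      using field_value_pos(2)[OF beta that(1)] by auto
    moreover have "crit_field \<beta> z = - crit_field \<beta> \<bar>z\<bar>"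
      using crit_field_minus[of "- z" \<beta>] False that by auto
    ultimately show ?thesis
      using False that by (cases "z = 0") (auto simp: mult_less_0_iff)
  qed
  show ?thesis
  proof (cases "0 < h")
    case False
    have "crit_field \<beta> z = h \<longleftrightarrow> crit_field \<beta> (- z) = - h"
      using crit_field_minus[OF z, of \<beta>] by auto
    then show ?thesis
      using pos[of "- h" "- z"] False h z by (auto simp: field_value_minus)
  qed (use pos z in auto)
qed

lemma abs_field_value_less_1:
  assumes "h \<noteq> 0"
  shows "\<bar>field_value \<beta> h\<bar> < 1" and "0 < field_value \<beta> h * h"
  using field_value_pos[OF beta, of h] field_value_pos[OF beta, of "- h"] field_value_minus[OF assms, of \<beta>]
    assms by (cases "0 < h"; auto simp: mult_neg_neg)+

lemma critical_points_beyond_spinodal: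
  assumes "cw_spinodal \<beta> < \<bar>h\<bar>"
  shows "critical_points_in {-1<..<1} (cw_rate \<beta> h) = {field_value \<beta> h}"
proof -
  have h: "h \<noteq> 0"
    using assms cw_spinodal_pos[OF beta] by auto
  have "crit_field \<beta> z = h \<longleftrightarrow> z = field_value \<beta> h" if "\<bar>z\<bar> < 1" for z
    using crit_field_solutions[OF h that] crit_field_minimum(1)[of "\<bar>z\<bar>"] assms that by auto
  then show ?thesis
    unfolding critical_points_cw_rate using abs_field_value_less_1[OF h] by (auto simp: abs_less_iff)
qed

lemma critical_points_at_spinodal:
  assumes "\<bar>h\<bar> = cw_spinodal \<beta>"
  shows "critical_points_in {-1<..<1} (cw_rate \<beta> h)
    = {field_value \<beta> h, - sgn h * spinodal_point \<beta>}"
proof -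
  have h: "h \<noteq> 0"
    using assms cw_spinodal_pos[OF beta] by auto
  note s = spinodal_point_bounds[OF beta]
  have "crit_field \<beta> z = h \<longleftrightarrow> z = field_value \<beta> h \<or> z = - sgn h * spinodal_point \<beta>"
    if "\<bar>z\<bar> < 1" for z
  proof -
    have "crit_field \<beta> \<bar>z\<bar> = - \<bar>h\<bar> \<longleftrightarrow> \<bar>z\<bar> = spinodal_point \<beta>"
      using crit_field_minimum(2)[of "\<bar>z\<bar>"] assms that by auto
    moreover have "z * h < 0 \<and> \<bar>z\<bar> = spinodal_point \<beta> \<longleftrightarrow> z = - sgn h * spinodal_point \<beta>"
      using h s by (auto simp: sgn_if mult_less_0_iff)
    ultimately show ?thesis
      using crit_field_solutions[OF h that] by auto
  qed
  moreover have "\<bar>- sgn h * spinodal_point \<beta>\<bar> < 1"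
    using h s by (auto simp: abs_mult)
  ultimately show ?thesis
    unfolding critical_points_cw_rate using abs_field_value_less_1[OF h]
    by (auto simp: abs_less_iff)
qed

lemma cw_metastable_exists_pos:
  assumes h: "0 < h" "h < cw_spinodal \<beta>"
  shows "\<exists>zg zl zm. cw_metastable \<beta> h zg zl zm"
proof -
  let ?s = "spinodal_point \<beta>" and ?x = "upper_branch \<beta> (- h)" and ?zg = "field_value \<beta> h"
  note s = spinodal_point_bounds[OF beta]
  have x: "?s < ?x" "?x < 1" "crit_field \<beta> ?x = - h"
    using upper_branch[OF beta, of "- h"] h by auto
  \<comment> \<open>The level \<open>- h\<close> is attained on both sides of the spinodal point; \<open>- ?x\<close> is the local maximum
    and \<open>- y\<close> the local minimum.\<close>
  obtain y where y: "0 \<le> y" "y \<le> ?s" "crit_field \<beta> y = - h"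
    using IVT2'[of "crit_field \<beta>" ?s "- h" 0] h s continuous_crit_field[of "{0..?s}" \<beta>]
    by (auto simp: cw_spinodal_eq[OF beta] subset_iff)
  have "y \<noteq> 0" "y \<noteq> ?s"
    using y(3) h by (auto simp: cw_spinodal_eq[OF beta])
  with y have y: "0 < y" "y < ?s" "crit_field \<beta> y = - h"
    by auto
  have cf: "crit_field \<beta> z = - crit_field \<beta> (- z)" if "-1 < z" "z < 0" for z
    using crit_field_minus[of "- z" \<beta>] that by auto
  have der: "(cw_rate \<beta> h has_real_derivative h - crit_field \<beta> z) (at z)" if "-1 < z" "z < 0" for z
    using cw_rate_has_derivative[of z] that by auto
  have "cw_rate \<beta> h z < cw_rate \<beta> h (- ?x)" if "z \<in> {-1<..<- ?s}" "z \<noteq> - ?x" for z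
  proof (rule strict_max_on_interval[where a = "-1" and b = "- ?s" and f = "cw_rate \<beta> h"
        and f' = "\<lambda>z. h - crit_field \<beta> z"])
    show "0 < h - crit_field \<beta> z" if "-1 < z" "z < - ?x" for z
      using crit_field_increasing[OF beta, of ?x "- z"] that x s cf[of z] by simp
    show "h - crit_field \<beta> z < 0" if "- ?x < z" "z < - ?s" for z
      using crit_field_increasing[OF beta, of "- z" ?x] that x s cf[of z] by simp
  qed (use der that x s in auto)
  moreover have "eventually (\<lambda>z. z \<in> {-1<..<- ?s}) (at (- ?x) within {-1..1})"
    using x by (intro eventually_at_topological[THEN iffD2] exI[of _ "{-1<..<- ?s}"]) auto
  ultimately have max: "strict_local_max_on {-1..1} (cw_rate \<beta> h) (- ?x)"
    using x s unfolding strict_local_max_on_def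
    by (auto elim!: eventually_mono simp: eventually_at_filter)
  have less: "- cw_rate \<beta> h z < - cw_rate \<beta> h (- y)" if "z \<in> {- ?s<..<0}" "z \<noteq> - y" for z
  proof (rule strict_max_on_interval[where a = "- ?s" and b = 0 and f = "\<lambda>z. - cw_rate \<beta> h z"
        and f' = "\<lambda>z. - (h - crit_field \<beta> z)"])
    show "((\<lambda>z. - cw_rate \<beta> h z) has_real_derivative - (h - crit_field \<beta> z)) (at z)"
      if "z \<in> {- ?s<..<0}" for z
      using der[of z] that s by (intro DERIV_minus) auto
    show "0 < - (h - crit_field \<beta> z)" if "- ?s < z" "z < - y" for z
      using crit_field_decreasing[OF beta, of y "- z"] that y s cf[of z] by simp
    show "- (h - crit_field \<beta> z) < 0" if "- y < z" "z < 0" for z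
      using crit_field_decreasing[OF beta, of "- z" y] that y s cf[of z] by simp
  qed (use that y s in auto)
  have "eventually (\<lambda>z. z \<in> {- ?s<..<0}) (at (- y) within {-1..1})"
    using y by (intro eventually_at_topological[THEN iffD2] exI[of _ "{- ?s<..<0}"]) auto
  then have "\<forall>\<^sub>F z in at (- y) within {-1..1}. cw_rate \<beta> h (- y) \<le> cw_rate \<beta> h z"
    by (rule eventually_mono) (use less in force)
  then have min: "local_min_on {-1..1} (cw_rate \<beta> h) (- y)"
    using y s by (simp add: local_min_on_def)
  have zg: "0 < ?zg"
    using field_value_pos(2)[OF beta h(1)] .
  then have "cw_metastable \<beta> h ?zg (- ?x) (- y)"
    using max min x y s h by (auto simp: cw_metastable_def unique_maximizer_cw_rate)
  then show ?thesis
    by blast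
qed

lemma cw_metastable_exists:
  assumes "0 < \<bar>h\<bar>" "\<bar>h\<bar> < cw_spinodal \<beta>"
  shows "\<exists>zg zl zm. cw_metastable \<beta> h zg zl zm"
proof (cases "0 < h")
  case False
  then show ?thesis
    using cw_metastable_exists_pos[of "- h"] cw_metastable_reflect[of \<beta> "- h"] assms by fastforce
qed (use assms cw_metastable_exists_pos in auto)

text \<open>However they are selected, the metastable maximum and the barrier are critical points on the
  side opposite to the field.\<close>

lemma cw_metastable_critical:
  assumes "h \<noteq> 0" "cw_metastable \<beta> h zg zl zm"
  shows "zl * h < 0" "\<bar>zl\<bar> < 1" "crit_field \<beta> \<bar>zl\<bar> = - \<bar>h\<bar>"
    and "zm * h < 0" "\<bar>zm\<bar> < 1" "crit_field \<beta> \<bar>zm\<bar> = - \<bar>h\<bar>"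
proof -
  define C where "C h z \<longleftrightarrow> z * h < 0 \<and> \<bar>z\<bar> < 1 \<and> crit_field \<beta> \<bar>z\<bar> = - \<bar>h\<bar>" for h z
  have pos: "C h zl \<and> C h zm" if h: "0 < h" and ms: "cw_metastable \<beta> h zg zl zm" for h zg zl zm
  proof -
    have zg: "zg = field_value \<beta> h"
      using ms h by (simp add: cw_metastable_def unique_maximizer_cw_rate)
    then have zg_pos: "0 < zg" "zg < 1"
      using field_value_pos[OF beta h] by auto
    have max: "strict_local_max_on {-1..1} (cw_rate \<beta> h) zl"
      and min: "local_min_on {-1..1} (cw_rate \<beta> h) zm"
      and "zl * zg < 0" "min zl zg < zm" "zm < max zl zg"
      using ms by (auto simp: cw_metastable_def)
    then have ord: "zl < 0" "zl < zm" "zm < zg"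
      using zg_pos by (auto simp: mult_less_0_iff)
    obtain d where d: "0 < d" "zl \<in> {-1..1}"
      "\<And>y. y \<in> {-1..1} \<Longrightarrow> y \<noteq> zl \<Longrightarrow> \<bar>y - zl\<bar> < d \<Longrightarrow> cw_rate \<beta> h y < cw_rate \<beta> h zl"
      using strict_local_max_onD[OF max] by metis
    have "zl \<noteq> -1"
      using max cw_rate_not_max_at_minus_one[OF h] by auto
    then have zl: "\<bar>zl\<bar> < 1"
      using d(2) ord by auto
    have "h - crit_field \<beta> zl = 0"
    proof (rule DERIV_local_max[OF cw_rate_has_derivative[OF zl]])
      show "\<forall>y. \<bar>zl - y\<bar> < min d (1 - \<bar>zl\<bar>) \<longrightarrow> cw_rate \<beta> h y \<le> cw_rate \<beta> h zl"
      proof (intro allI impI)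
        fix y assume "\<bar>zl - y\<bar> < min d (1 - \<bar>zl\<bar>)"
        then have "y \<in> {-1..1}" "\<bar>y - zl\<bar> < d"
          by auto
        then show "cw_rate \<beta> h y \<le> cw_rate \<beta> h zl"
          using d(3)[of y] by (cases "y = zl") auto
      qed
    qed (use d zl in auto)
    then have "C h zl"
      using crit_field_solutions[of h zl] h zl ord zg zg_pos by (auto simp: C_def)
    obtain e where e: "0 < e" "zm \<in> {-1..1}"
      "\<And>y. y \<in> {-1..1} \<Longrightarrow> y \<noteq> zm \<Longrightarrow> \<bar>y - zm\<bar> < e \<Longrightarrow> cw_rate \<beta> h zm \<le> cw_rate \<beta> h y"
      using local_min_onD[OF min] by metis
    have zm: "\<bar>zm\<bar> < 1"
      using zl ord zg_pos by auto
    have "h - crit_field \<beta> zm = 0"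
    proof (rule DERIV_local_min[OF cw_rate_has_derivative[OF zm]])
      show "\<forall>y. \<bar>zm - y\<bar> < min e (1 - \<bar>zm\<bar>) \<longrightarrow> cw_rate \<beta> h zm \<le> cw_rate \<beta> h y"
      proof (intro allI impI)
        fix y assume "\<bar>zm - y\<bar> < min e (1 - \<bar>zm\<bar>)"
        then have "y \<in> {-1..1}" "\<bar>y - zm\<bar> < e"
          by auto
        then show "cw_rate \<beta> h zm \<le> cw_rate \<beta> h y"
          using e(3)[of y] by (cases "y = zm") auto
      qed
    qed (use e zm in auto)
    then have "C h zm"
      using crit_field_solutions[of h zm] h zm ord zg by (auto simp: C_def)
    with \<open>C h zl\<close> show ?thesis ..
  qed
  have "C h zl \<and> C h zm"
  proof (cases "0 < h")
    case False
    then have "C (- h) (- zl) \<and> C (- h) (- zm)"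
      using pos[of "- h" "- zg" "- zl" "- zm"] cw_metastable_reflect[OF assms(2)] assms(1) by simp
    then show ?thesis
      by (simp add: C_def)
  qed (use pos assms(2) in blast)
  then show "zl * h < 0" "\<bar>zl\<bar> < 1" "crit_field \<beta> \<bar>zl\<bar> = - \<bar>h\<bar>"
    and "zm * h < 0" "\<bar>zm\<bar> < 1" "crit_field \<beta> \<bar>zm\<bar> = - \<bar>h\<bar>"
    by (auto simp: C_def)
qed

text \<open>The minimum of \<open>crit_field \<beta>\<close> over \<open>(0, 1)\<close> is well separated: almost minimal values are
  attained only near the spinodal point.\<close>

lemma crit_field_near_minimum:
  assumes "0 < e"
  obtains d where "0 < d" "\<And>x. 0 < x \<Longrightarrow> x < 1 \<Longrightarrow> crit_field \<beta> x < - cw_spinodal \<beta> + d \<Longrightarrow>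
    \<bar>x - spinodal_point \<beta>\<bar> < e"
proof -
  let ?s = "spinodal_point \<beta>"
  note s = spinodal_point_bounds[OF beta]
  define r where "r = min e (min (?s / 2) ((1 - ?s) / 2))"
  have r: "0 < r" "r \<le> e" "0 < ?s - r" "?s + r < 1"
  proof -
    have "r \<le> ?s / 2" "r \<le> (1 - ?s) / 2"
      unfolding r_def by (blast intro: min.coboundedI1 min.coboundedI2)+
    moreover have "r \<le> e" "0 < r"
      using s assms by (auto simp: r_def)
    ultimately show "0 < r" "r \<le> e" "0 < ?s - r" "?s + r < 1"
      using s by (auto simp: field_simps)
  qed
  define d where "d = min (crit_field \<beta> (?s - r)) (crit_field \<beta> (?s + r)) + cw_spinodal \<beta>"
  have "0 < d"
    using crit_field_decreasing[OF beta, of "?s - r" ?s] crit_field_increasing[OF beta, of ?s "?s + r"]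
      r s by (simp add: d_def cw_spinodal_eq[OF beta])
  moreover have "\<bar>x - ?s\<bar> < e" if x: "0 < x" "x < 1" "crit_field \<beta> x < - cw_spinodal \<beta> + d" for x
  proof -
    have "crit_field \<beta> x < crit_field \<beta> (?s - r)" "crit_field \<beta> x < crit_field \<beta> (?s + r)"
      using x(3) by (auto simp: d_def)
    moreover have "crit_field \<beta> (?s - r) \<le> crit_field \<beta> x" if "x \<le> ?s - r"
      using crit_field_decreasing[OF beta, of x "?s - r"] that r s x
      by (cases "x = ?s - r") auto
    moreover have "crit_field \<beta> (?s + r) \<le> crit_field \<beta> x" if "?s + r \<le> x"
      using crit_field_increasing[OF beta, of "?s + r" x] that r s x
      by (cases "x = ?s + r") auto
    ultimately have "?s - r < x" "x < ?s + r"
      by (meson not_less)+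
    then show ?thesis
      using r by linarith
  qed
  ultimately show ?thesis
    using that by blast
qed

lemma cw_coalescence_at_spinodal:
  assumes k: "\<bar>k\<bar> = cw_spinodal \<beta>"
  shows "cw_coalescence \<beta> k (field_value \<beta> k) (- sgn k * spinodal_point \<beta>)"
proof -
  let ?s = "spinodal_point \<beta>"
  let ?H = "{h. 0 < \<bar>h\<bar> \<and> \<bar>h\<bar> < cw_spinodal \<beta>}"
  have k0: "k \<noteq> 0"
    using k cw_spinodal_pos[OF beta] by auto
  note s = spinodal_point_bounds[OF beta]
  have lim: "(y \<longlongrightarrow> - sgn k * ?s) (at k within ?H)"
    if y: "\<And>h. h \<in> ?H \<Longrightarrow> y h * h < 0 \<and> \<bar>y h\<bar> < 1 \<and> crit_field \<beta> \<bar>y h\<bar> = - \<bar>h\<bar>" for y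
    unfolding tendsto_iff eventually_at
  proof (intro allI impI)
    fix e :: real assume "0 < e"
    then obtain d where d: "0 < d" "\<And>x. 0 < x \<Longrightarrow> x < 1 \<Longrightarrow> crit_field \<beta> x < - cw_spinodal \<beta> + d \<Longrightarrow>
        \<bar>x - ?s\<bar> < e"
      by (rule crit_field_near_minimum) blast
    have "dist (y h) (- sgn k * ?s) < e" if h: "h \<in> ?H" "dist h k < min d \<bar>k\<bar>" for h
    proof -
      have "\<bar>k\<bar> - d < \<bar>h\<bar>" and sg: "sgn h = sgn k"
        using h(2) k0 by (auto simp: dist_real_def sgn_if abs_if split: if_splits)
      then have "crit_field \<beta> \<bar>y h\<bar> < - cw_spinodal \<beta> + d"
        using y[OF h(1)] k by auto
      then have "\<bar>\<bar>y h\<bar> - ?s\<bar> < e"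
        using y[OF h(1)] by (intro d(2)) auto
      moreover have "y h = - sgn k * \<bar>y h\<bar>"
        using y[OF h(1)] k0 unfolding sg[symmetric] by (auto simp: sgn_if mult_less_0_iff)
      then have "dist (y h) (- sgn k * ?s) = \<bar>- sgn k * (\<bar>y h\<bar> - ?s)\<bar>"
        by (metis dist_real_def right_diff_distrib)
      ultimately show ?thesis
        using k0 by (simp add: abs_mult)
    qed
    then show "\<exists>d>0. \<forall>h\<in>?H. h \<noteq> k \<and> dist h k < d \<longrightarrow> dist (y h) (- sgn k * ?s) < e"
      using d(1) k0 by (intro exI[of _ "min d \<bar>k\<bar>"]) auto
  qed
  have "- sgn k * ?s * field_value \<beta> k < 0"
    using abs_field_value_less_1(2)[OF k0] s k0
    by (auto simp: sgn_if zero_less_mult_iff mult_less_0_iff)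
  moreover have "(yl \<longlongrightarrow> - sgn k * ?s) (at k within ?H) \<and> (ym \<longlongrightarrow> - sgn k * ?s) (at k within ?H)"
    if "\<forall>h. 0 < \<bar>h\<bar> \<and> \<bar>h\<bar> < cw_spinodal \<beta> \<longrightarrow> cw_metastable \<beta> h (yg h) (yl h) (ym h)"
    for yg yl ym :: "real \<Rightarrow> real"
    using that cw_metastable_critical by (intro conjI lim) auto
  ultimately show ?thesis
    unfolding cw_coalescence_def
    using k0 critical_points_at_spinodal[OF k] unique_maximizer_cw_rate by blast
qed

section \<open>The phase transition\<close>

lemma cw_pressure_derivative_left: "(cw_pressure \<beta> has_real_derivative - cw_mag \<beta>) (at_left 0)"
proof -
  have "((\<lambda>k. mean_field \<beta> k (upper_branch \<beta> k)) has_real_derivative upper_branch \<beta> 0) (at (- 0))"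
    using mean_field_upper_branch_has_derivative[OF beta, of 0] cw_spinodal_pos[OF beta] by simp
  then have "((\<lambda>k. mean_field \<beta> (- k) (upper_branch \<beta> (- k))) has_real_derivative - upper_branch \<beta> 0)
      (at 0)"
    using DERIV_chain2[of "\<lambda>k. mean_field \<beta> k (upper_branch \<beta> k)" "upper_branch \<beta> 0" uminus 0 "-1" UNIV]
      DERIV_minus[OF DERIV_ident, of "0 :: real" UNIV] by simp
  then have "((\<lambda>k. mean_field \<beta> (- k) (upper_branch \<beta> (- k))) has_real_derivative - upper_branch \<beta> 0)
      (at 0 within {..0})"
    by (rule has_field_derivative_at_within)
  then have "(cw_pressure \<beta> has_real_derivative - upper_branch \<beta> 0) (at 0 within {..0})"
    by (rule has_field_derivative_transform_within[of _ _ _ _ 1])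
      (auto simp: cw_pressure_nonneg[OF beta, symmetric] cw_pressure_minus[OF beta])
  then show ?thesis
    by (simp add: cw_mag_eq[OF beta] at_within_Iic_at_left)
qed

lemma cw_mag_bounds: "cw_mag \<beta> \<in> {0<..<1}"
  using upper_branch[OF beta, of 0] cw_spinodal_pos[OF beta] by (simp add: cw_mag_eq[OF beta])

lemma first_order_transition_cw_pressure: "first_order_transition (cw_pressure \<beta>) 0"
proof -
  have "continuous_on UNIV (cw_pressure \<beta>)"
    by (rule convex_on_continuous[OF open_UNIV convex_cw_pressure[OF beta]])
  then have "isCont (cw_pressure \<beta>) 0"
    by (simp add: continuous_on_eq_continuous_at)
  moreover have "- cw_mag \<beta> \<noteq> cw_mag \<beta>"
    using cw_mag_bounds by auto
  ultimately show ?thesis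
    unfolding first_order_transition_def
    using cw_pressure_derivative_left cw_pressure_derivative_right[OF beta] by blast
qed

lemma has_jump_cw_value: "has_jump (cw_value \<beta>) 0 (2 * cw_mag \<beta>)"
proof -
  have cont: "(upper_branch \<beta> \<longlongrightarrow> cw_mag \<beta>) (at 0)"
    using isCont_upper_branch[OF beta, of 0] cw_spinodal_pos[OF beta]
    by (simp add: isCont_def cw_mag_eq[OF beta])
  have right: "(upper_branch \<beta> \<longlongrightarrow> cw_mag \<beta>) (at_right 0)"
    using cont by (rule filterlim_mono) (auto intro: at_le)
  have left: "((\<lambda>h. - upper_branch \<beta> (- h)) \<longlongrightarrow> - cw_mag \<beta>) (at_left 0)"
    using right by (intro tendsto_minus) (simp add: filterlim_at_left_to_right)
  have "(cw_value \<beta> \<longlongrightarrow> cw_mag \<beta>) (at_right 0)"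
    by (rule Lim_transform_eventually[OF right])
      (auto simp: eventually_at_filter cw_value_eq[OF beta] field_value_def)
  moreover have "(cw_value \<beta> \<longlongrightarrow> - cw_mag \<beta>) (at_left 0)"
    by (rule Lim_transform_eventually[OF left])
      (auto simp: eventually_at_filter cw_value_eq[OF beta] field_value_def)
  ultimately show ?thesis
    unfolding has_jump_def by (intro exI[of _ "cw_mag \<beta>"] exI[of _ "- cw_mag \<beta>"]) auto
qed

lemma convergent_finite_pressure: "convergent (finite_pressure full_map (cw_energy \<beta> h))"
proof -
  obtain z where "\<And>y. mean_field \<beta> h y \<le> mean_field \<beta> h z"
    using mean_field_max_exists[OF beta] by blast
  then show ?thesis
    using beta by (intro convergentI[OF finite_pressure_tendsto]) auto
qed

lemma equilibrium_values_at_zero: "cw_equilibrium_values \<beta> 0 = {cw_mag \<beta>, - cw_mag \<beta>}"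
  unfolding cw_equilibrium_values_eq cw_mag_eq[OF beta]
  using arg_max_mean_rate_nonneg[OF beta order_refl] by blast

lemma cw_value_properties:
  assumes "h \<noteq> 0"
  shows "\<exists>!z. z \<in> cw_equilibrium_values \<beta> h"
    and "sgn (cw_value \<beta> h) = sgn h"
    and "cw_value \<beta> h = tanh (\<beta> * cw_value \<beta> h + h)"
    and "h > 0 \<Longrightarrow> cw_value \<beta> h \<in> {cw_mag \<beta><..<1}"
    and "h < 0 \<Longrightarrow> cw_value \<beta> h \<in> {-1<..<- cw_mag \<beta>}"
proof -
  note eq = cw_value_eq[OF beta assms]
  show "\<exists>!z. z \<in> cw_equilibrium_values \<beta> h"
    unfolding cw_equilibrium_values_eq mem_Collect_eq arg_max_mean_rate[OF beta assms] by simp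
  show "sgn (cw_value \<beta> h) = sgn h"
    using abs_field_value_less_1(2)[OF assms] by (auto simp: eq sgn_if zero_less_mult_iff)
  show "cw_value \<beta> h = tanh (\<beta> * cw_value \<beta> h + h)"
    unfolding eq by (rule field_value_tanh[OF beta assms])
  show "cw_value \<beta> h \<in> {cw_mag \<beta><..<1}" if "h > 0"
    unfolding eq by (rule field_value_pos(1)[OF beta that])
  show "cw_value \<beta> h \<in> {-1<..<- cw_mag \<beta>}" if "h < 0"
    using field_value_pos(1)[OF beta, of "- h"] that by (simp add: eq field_value_minus)
qed

lemma equilibrium_pair_at_nonzero_field:
  assumes "h \<noteq> 0"
  defines "p \<equiv> spin_prob (cw_value \<beta> h)"
  shows "equilibrium_pair full_map (cw_energy \<beta> h) p (\<lambda>s. p)"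
    and "equilibrium_pair full_map (cw_energy \<beta> h) \<mu> Q \<Longrightarrow> same_pair \<mu> Q p (\<lambda>s. p)"
proof -
  show "equilibrium_pair full_map (cw_energy \<beta> h) p (\<lambda>s. p)"
    unfolding p_def cw_value_eq[OF beta assms(1)]
    using arg_max_mean_rate[OF beta assms(1)] by (blast intro: equilibrium_pair_product)
  assume "equilibrium_pair full_map (cw_energy \<beta> h) \<mu> Q"
  from equilibrium_pairD[OF this] show "same_pair \<mu> Q p (\<lambda>s. p)"
    unfolding p_def cw_value_eq[OF beta assms(1)]
    using arg_max_mean_rate[OF beta assms(1)] by metis
qed

end

theorem proposition7p4:
  fixes \<beta> :: real
  assumes "\<beta> > 1"
  shows "
    ((\<exists>!m. 0 < m \<and> m = tanh (\<beta> * m)) \<and> cw_mag \<beta> \<in> {0<..<1} \<and>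
     (\<forall>h. convergent (finite_pressure full_map (cw_energy \<beta> h)))) \<and>

    (cw_equilibrium_values \<beta> 0 = {cw_mag \<beta>, - cw_mag \<beta>} \<and>
     (\<forall>h. h \<noteq> 0 \<longrightarrow>
        (\<exists>!z. z \<in> cw_equilibrium_values \<beta> h) \<and>
        sgn (cw_value \<beta> h) = sgn h \<and>
        cw_value \<beta> h = tanh (\<beta> * cw_value \<beta> h + h) \<and>
        (h > 0 \<longrightarrow> cw_value \<beta> h \<in> {cw_mag \<beta><..<1}) \<and>
        (h < 0 \<longrightarrow> cw_value \<beta> h \<in> {-1<..<- cw_mag \<beta>}))) \<and>

    (\<forall>h. h \<noteq> 0 \<longrightarrow>
       (let p = spin_prob (cw_value \<beta> h) in
          equilibrium_pair full_map (cw_energy \<beta> h) p (\<lambda>s. p) \<and>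
          (\<forall>\<mu> Q. equilibrium_pair full_map (cw_energy \<beta> h) \<mu> Q \<longrightarrow> same_pair \<mu> Q p (\<lambda>s. p)) \<and>
          two_coord p (\<lambda>s. p) = (\<lambda>(s, t). p s * p t))) \<and>

    ((\<forall>h. cw_pressure \<beta> (- h) = cw_pressure \<beta> h) \<and>
     convex_on UNIV (cw_pressure \<beta>) \<and>
     real_analytic_on (cw_pressure \<beta>) {..<0} \<and>
     real_analytic_on (cw_pressure \<beta>) {0<..} \<and>
     (\<forall>h. h \<noteq> 0 \<longrightarrow>
        cw_pressure \<beta> h =
          ln (2 * cosh (\<beta> * cw_value \<beta> h + h)) - \<beta> / 2 * (cw_value \<beta> h)\<^sup>2) \<and>
     (cw_pressure \<beta> has_real_derivative - cw_mag \<beta>) (at_left 0) \<and>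
     (cw_pressure \<beta> has_real_derivative cw_mag \<beta>) (at_right 0) \<and>
     first_order_transition (cw_pressure \<beta>) 0 \<and>
     has_jump (cw_value \<beta>) 0 (2 * cw_mag \<beta>)) \<and>

    (cw_spinodal \<beta> > 0 \<and>
     (\<forall>h. 0 < \<bar>h\<bar> \<and> \<bar>h\<bar> < cw_spinodal \<beta> \<longrightarrow> (\<exists>zg zl zm. cw_metastable \<beta> h zg zl zm)) \<and>
     (\<forall>h. \<bar>h\<bar> = cw_spinodal \<beta> \<longrightarrow> (\<exists>zg c. cw_coalescence \<beta> h zg c)) \<and>
     (\<forall>h. \<bar>h\<bar> > cw_spinodal \<beta> \<longrightarrow>
        (\<exists>zg. unique_maximizer_on {-1..1} (cw_rate \<beta> h) zg \<and>
              critical_points_in {-1<..<1} (cw_rate \<beta> h) = {zg})))"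
proof -
  note beta = assms
  have h0: "h \<noteq> 0" if "\<bar>h\<bar> > cw_spinodal \<beta>" for h
    using that cw_spinodal_pos[OF beta] by auto
  have beyond: "\<exists>zg. unique_maximizer_on {-1..1} (cw_rate \<beta> h) zg \<and>
      critical_points_in {-1<..<1} (cw_rate \<beta> h) = {zg}" if "\<bar>h\<bar> > cw_spinodal \<beta>" for h
    using critical_points_beyond_spinodal[OF beta that] unique_maximizer_cw_rate[OF beta h0[OF that]]
    by blast
  have mag: "\<exists>!m. 0 < m \<and> m = tanh (\<beta> * m)"
    unfolding mag_equation_iff[OF beta] by simp
  have two: "two_coord p (\<lambda>s. p) = (\<lambda>(s, t). p s * p t)" for p :: "spin \<Rightarrow> real"
    by (simp add: two_coord_def)
  have formula: "cw_pressure \<beta> h = ln (2 * cosh (\<beta> * cw_value \<beta> h + h)) - \<beta> / 2 * (cw_value \<beta> h)\<^sup>2"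
    if "h \<noteq> 0" for h
    using cw_pressure_field_value[OF beta that] by (simp add: cw_value_eq[OF beta that] mean_field_def)
  have coalesce: "\<exists>zg c. cw_coalescence \<beta> h zg c" if "\<bar>h\<bar> = cw_spinodal \<beta>" for h
    using cw_coalescence_at_spinodal[OF beta that] by blast
  have metastable: "\<exists>zg zl zm. cw_metastable \<beta> h zg zl zm" if "0 < \<bar>h\<bar> \<and> \<bar>h\<bar> < cw_spinodal \<beta>" for h
    using cw_metastable_exists[OF beta] that by blast
  show ?thesis
    unfolding Let_def
    by (intro conjI allI impI; rule mag cw_mag_bounds[OF beta] convergent_finite_pressure[OF beta]
        equilibrium_values_at_zero[OF beta] cw_value_properties[OF beta]
        equilibrium_pair_at_nonzero_field[OF beta] two cw_pressure_minus[OF beta]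
        convex_cw_pressure[OF beta] real_analytic_cw_pressure_neg[OF beta]
        real_analytic_cw_pressure_pos[OF beta] formula cw_pressure_derivative_left[OF beta]
        cw_pressure_derivative_right[OF beta] first_order_transition_cw_pressure[OF beta]
        has_jump_cw_value[OF beta] cw_spinodal_pos[OF beta] metastable coalesce beyond; assumption)
qed

end
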